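(* Let $0<\kappa<1$ and let $f\in L^1(\mathscr U)$, $g\in L^1(\mathscr V)$ be positive with $\int_{\mathscr U}f=\int_{\mathscr V}g$. Assume $\mathscr U$ and $\mathscr V$ satisfy the two visibility conditions of the context, and let $\rho$ be a Brenier solution of the near field refractor problem such that, for every $X\in\mathscr U$, $Z\in\mathcal R(X)$ and $Y=(Z-\rho(X)X)/|Z-\rho(X)X|=(y,y_{n+1})$, one has $y_{n+1}>0$, $\frac{\partial\psi}{\partial z_{n+1}}(Z)>0$, $\nabla\psi(Z)\cdot Y>0$, and such that $\operatorname{dist}(\mathscr U,\mathscr V)>0$. Then $\rho$ is an Aleksandrov type solution, i.e. for every Borel set $E\subset\mathscr U$, $$\int_Ef=\int_{\mathcal R(E)}g .$$
   Context: Setting. $n\ge2$; $\mathscr U$ is an open subset of the upper unit hemisphere $\mathbb S^n_+\subset\mathbb R^{n+1}$; $\Sigma=\{\psi=0\}$ is a regular hypersurface in $\mathbb R^{n+1}$ given by $\psi(Z)=z_{n+1}-\varphi(z)$, $Z=(z,z_{n+1})$, with $\varphi$ smooth; $\mathscr V\subset\Sigma$ is relatively open. Integrals are with respect to surface measure. $O$ is the origin (light source) in a medium of refractive index $n_1$, the target lies in a medium of index $n_2$, $\kappa=n_1/n_2<1$. Ovals. For $P\in\mathbb R^{n+1}$ and $|P|<b<|P|/\kappa$, $\mathcal O(P,b)=\{M:|M|+\frac1\kappa|M-P|=b\}$ and $\mathcal O^-(P,b)=\{M\in\mathcal O(P,b):\frac{M}{|M|}\cdot P\ge\kappa^2\big(b+\sqrt{(\kappa^{-2}-1)(\kappa^{-2}|P|^2-b^2)}\big)\}$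 (its refracting part: rays from $O$ hitting it are refracted into $P$). Refractors. $\Gamma=\{\rho(X)X:X\in\mathscr U\}$, $\rho>0$, is a refractor if for every $X_0\in\mathscr U$ there are $P\in\mathscr V$ and $b>0$ such that $\mathcal O^-(P,b)$ supports $\rho$ at $X_0$: $\rho(X)+\frac1\kappa|\rho(X)X-P|\le b$ for all $X\in\mathscr U$ with equality at $X_0$. $\mathcal R(X_0)$ is the set of all such $P$ (imaging map), $\mathcal R(E)=\bigcup_{X\in E}\mathcal R(X)$, $\mathcal R^{-1}(G)=\{X\in\mathscr U:\mathcal R(X)\cap G\ne\emptyset\}$. It is a Brenier solution if $\int_{\mathcal R^{-1}(G)}f=\int_Gg$ for every Borel $G\subset\mathscr V$; the solutions considered are at positive distance from $O$ and from $\mathscr V$. Visibility conditions. (i) There is $0<\tau<1-\kappa$ with $X\cdot\frac P{|P|}\ge\kappa+\tau$ for all $X\in\mathscr U,P\in\mathscr V$. (ii) There is a small cone $Q_{r_0}$ with vertex $O$ in which every line passing through $O$ intersects $\mathscr V$ in at most one point. *)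

theory Defs
  imports "HOL-Analysis.Analysis"
begin

text \<open>
  The ambient space \<open>\<real>\<^sup>n\<^sup>+\<^sup>1\<close> is the Euclidean space \<open>(real^'n) \<times> real\<close> with \<open>n = CARD('n)\<close>, so that a point
  is literally a pair \<open>Z = (z, z\<^sub>n\<^sub>+\<^sub>1)\<close>.
\<close>

type_synonym 'n space = "(real^'n) \<times> real"

definition upper_hemisphere :: "('n::finite) space set" where
  "upper_hemisphere = {X. norm X = 1 \<and> snd X > 0}"

primrec C_k :: "nat \<Rightarrow> ('a::real_normed_vector \<Rightarrow> real) \<Rightarrow> bool" where
  "C_k 0 f \<longleftrightarrow> continuous_on UNIV f"
| "C_k (Suc k) f \<longleftrightarrow>
     (\<exists>f'. (\<forall>x. (f has_derivative f' x) (at x)) \<and> (\<forall>v. C_k k (\<lambda>x. f' x v)))"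

definition smooth :: "('a::real_normed_vector \<Rightarrow> real) \<Rightarrow> bool" where
  "smooth f \<longleftrightarrow> (\<forall>k. C_k k f)"

definition grad :: "('a::euclidean_space \<Rightarrow> real) \<Rightarrow> 'a \<Rightarrow> 'a" where
  "grad f x = (\<Sum>b\<in>Basis. frechet_derivative f (at x) b *\<^sub>R b)"

definition psi :: "(real^'n \<Rightarrow> real) \<Rightarrow> ('n::finite) space \<Rightarrow> real" where
  "psi \<phi> Z = snd Z - \<phi> (fst Z)"

definition hypersurface :: "(real^'n \<Rightarrow> real) \<Rightarrow> ('n::finite) space set" where
  "hypersurface \<phi> = {Z. psi \<phi> Z = 0}"


text \<open>
  Surface measure of the graph of \<open>h\<close> over an open set \<open>D\<close>, by the area formula
  \<open>d\<sigma> = sqrt (1 + |\<nabla>h|\<^sup>2) dx\<close>. It is regarded as a measure on the whole ambient space, concentrated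
  on the graph, and completed: images of Borel sets under the multivalued imaging map need not be
  Borel.
\<close>

definition graph_surface_measure ::
    "(real^'n) set \<Rightarrow> (real^'n \<Rightarrow> real) \<Rightarrow> ('n::finite) space measure" where
  "graph_surface_measure D h =
     completion (distr
       (density (restrict_space lborel D) (\<lambda>x. ennreal (sqrt (1 + (norm (grad h x))\<^sup>2))))
       borel (\<lambda>x. (x, h x)))"

definition hemisphere_measure :: "('n::finite) space measure" where
  "hemisphere_measure = graph_surface_measure (ball 0 1) (\<lambda>x. sqrt (1 - (norm x)\<^sup>2))"

definition target_measure :: "(real^'n \<Rightarrow> real) \<Rightarrow> ('n::finite) space measure" where
  "target_measure \<phi> = graph_surface_measure UNIV \<phi>"


definition oval :: "real \<Rightarrow> ('n::finite) space \<Rightarrow> real \<Rightarrow> 'n space set" where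
  "oval \<kappa> P b = {M. norm M + (1 / \<kappa>) * norm (M - P) = b}"

definition oval_minus :: "real \<Rightarrow> ('n::finite) space \<Rightarrow> real \<Rightarrow> 'n space set" where
  "oval_minus \<kappa> P b =
     {M \<in> oval \<kappa> P b. (M /\<^sub>R norm M) \<bullet> P \<ge>
        \<kappa>\<^sup>2 * (b + sqrt ((1 / \<kappa>\<^sup>2 - 1) * ((norm P)\<^sup>2 / \<kappa>\<^sup>2 - b\<^sup>2)))}"

text \<open>
  The bounds on \<open>b\<close> are those for which the oval is defined. Membership of the contact point in
  \<open>oval_minus \<kappa> P b\<close> subsumes equality at \<open>X0\<close>, because \<open>norm X0 = 1\<close> and \<open>\<rho> X0 > 0\<close> wherever this is used.
\<close>

definition supports ::
    "real \<Rightarrow> ('n::finite) space set \<Rightarrow> ('n space \<Rightarrow> real) \<Rightarrow> 'n space \<Rightarrow> real \<Rightarrow> 'n space \<Rightarrow> bool" where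
  "supports \<kappa> U \<rho> P b X0 \<longleftrightarrow>
     norm P < b \<and> b < norm P / \<kappa> \<and>
     (\<forall>X\<in>U. \<rho> X + (1 / \<kappa>) * norm (\<rho> X *\<^sub>R X - P) \<le> b) \<and>
     \<rho> X0 + (1 / \<kappa>) * norm (\<rho> X0 *\<^sub>R X0 - P) = b \<and>
     \<rho> X0 *\<^sub>R X0 \<in> oval_minus \<kappa> P b"

definition imaging ::
    "real \<Rightarrow> ('n::finite) space set \<Rightarrow> 'n space set \<Rightarrow> ('n space \<Rightarrow> real) \<Rightarrow> 'n space \<Rightarrow> 'n space set" where
  "imaging \<kappa> U V \<rho> X0 = {P \<in> V. \<exists>b>0. supports \<kappa> U \<rho> P b X0}"

definition imaging_image ::
    "real \<Rightarrow> ('n::finite) space set \<Rightarrow> 'n space set \<Rightarrow> ('n space \<Rightarrow> real) \<Rightarrow> 'n space set \<Rightarrow> 'n space set" where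
  "imaging_image \<kappa> U V \<rho> E = (\<Union>X\<in>E. imaging \<kappa> U V \<rho> X)"

definition imaging_preimage ::
    "real \<Rightarrow> ('n::finite) space set \<Rightarrow> 'n space set \<Rightarrow> ('n space \<Rightarrow> real) \<Rightarrow> 'n space set \<Rightarrow> 'n space set" where
  "imaging_preimage \<kappa> U V \<rho> G = {X \<in> U. imaging \<kappa> U V \<rho> X \<inter> G \<noteq> {}}"

definition refractor ::
    "real \<Rightarrow> ('n::finite) space set \<Rightarrow> 'n space set \<Rightarrow> ('n space \<Rightarrow> real) \<Rightarrow> bool" where
  "refractor \<kappa> U V \<rho> \<longleftrightarrow> (\<forall>X\<in>U. \<rho> X > 0) \<and>
     (\<forall>X0\<in>U. \<exists>P\<in>V. \<exists>b>0. supports \<kappa> U \<rho> P b X0)"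

definition refractor_surface ::
    "('n::finite) space set \<Rightarrow> ('n space \<Rightarrow> real) \<Rightarrow> 'n space set" where
  "refractor_surface U \<rho> = {\<rho> X *\<^sub>R X |X. X \<in> U}"


text \<open>
  In both notions of solution, measurability of the domain of integration is made explicit, since
  the Bochner integral is zero by convention when it is not defined.
\<close>

definition brenier_solution ::
    "real \<Rightarrow> (real^'n \<Rightarrow> real) \<Rightarrow> ('n::finite) space set \<Rightarrow> 'n space set \<Rightarrow>
     ('n space \<Rightarrow> real) \<Rightarrow> ('n space \<Rightarrow> real) \<Rightarrow> ('n space \<Rightarrow> real) \<Rightarrow> bool" where
  "brenier_solution \<kappa> \<phi> U V f g \<rho> \<longleftrightarrow> refractor \<kappa> U V \<rho> \<and>
     (\<forall>G\<in>sets borel. G \<subseteq> V \<longrightarrow>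
        imaging_preimage \<kappa> U V \<rho> G \<in> sets hemisphere_measure \<and>
        (LINT X:imaging_preimage \<kappa> U V \<rho> G|hemisphere_measure. f X)
          = (LINT Z:G|target_measure \<phi>. g Z))"

definition aleksandrov_solution ::
    "real \<Rightarrow> (real^'n \<Rightarrow> real) \<Rightarrow> ('n::finite) space set \<Rightarrow> 'n space set \<Rightarrow>
     ('n space \<Rightarrow> real) \<Rightarrow> ('n space \<Rightarrow> real) \<Rightarrow> ('n space \<Rightarrow> real) \<Rightarrow> bool" where
  "aleksandrov_solution \<kappa> \<phi> U V f g \<rho> \<longleftrightarrow> refractor \<kappa> U V \<rho> \<and>
     (\<forall>E\<in>sets borel. E \<subseteq> U \<longrightarrow>
        imaging_image \<kappa> U V \<rho> E \<in> sets (target_measure \<phi>) \<and>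
        (LINT X:E|hemisphere_measure. f X)
          = (LINT Z:imaging_image \<kappa> U V \<rho> E|target_measure \<phi>. g Z))"


text \<open>For nonempty sets this is \<open>setdist A B > 0\<close>; \<open>setdist\<close> is zero when a set is empty.\<close>

definition positive_distance :: "'a::metric_space set \<Rightarrow> 'a set \<Rightarrow> bool" where
  "positive_distance A B \<longleftrightarrow> (\<exists>d>0. \<forall>x\<in>A. \<forall>y\<in>B. d \<le> dist x y)"

definition visibility_1 :: "real \<Rightarrow> ('n::finite) space set \<Rightarrow> 'n space set \<Rightarrow> bool" where
  "visibility_1 \<kappa> U V \<longleftrightarrow>
     (\<exists>\<tau>>0. \<tau> < 1 - \<kappa> \<and> (\<forall>X\<in>U. \<forall>P\<in>V. X \<bullet> (P /\<^sub>R norm P) \<ge> \<kappa> + \<tau>))"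

text \<open>The cone with vertex \<open>O\<close> and height \<open>r\<close> formed by the rays in the directions of \<open>U\<close>.\<close>

definition ray_cone :: "('n::finite) space set \<Rightarrow> real \<Rightarrow> 'n space set" where
  "ray_cone U r = {t *\<^sub>R X |t X. X \<in> U \<and> 0 < t \<and> t < r}"

text \<open>For \<open>Q \<noteq> 0\<close>, \<open>span {Q}\<close> is the line through \<open>O\<close> and \<open>Q\<close>.\<close>

definition visibility_2 :: "('n::finite) space set \<Rightarrow> 'n space set \<Rightarrow> bool" where
  "visibility_2 U V \<longleftrightarrow>
     (\<exists>r0>0. \<forall>Q\<in>ray_cone U r0. \<forall>P\<in>V \<inter> span {Q}. \<forall>P'\<in>V \<inter> span {Q}. P = P')"

end

theory Submission
  imports Defs
begin

text \<open>
  The optical path length \<open>norm M + norm (M - P) / \<kappa>\<close>, maximised over points \<open>M\<close> of the refractor, is a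
  function \<open>\<beta>\<close> of the target point \<open>P\<close>, and \<open>P\<close> lies in the image of a direction only if the maximum is
  attained there. Two maximisers for the same \<open>P\<close> must give \<open>\<beta>\<close> different one-sided slopes along some
  coordinate direction of the graph: the slopes determine the tangential part of the unit vector
  from \<open>M\<close> to \<open>P\<close>, the sign condition \<open>\<nabla>\<psi> \<bullet> Y > 0\<close> then determines the vector, and on a ray into \<open>P\<close> the
  path length is strictly monotone as \<open>\<kappa> < 1\<close>. Corners in a fixed direction form a null set,
  hence almost every target point has at most one preimage.

  Additivity of the measure of preimages forces the imaging map to be
  single-valued almost everywhere. By Lusin's theorem a Borel set \<open>E\<close> and its complement are, up to null
  sets, countable unions of compact sets with compact images. Both images are almost disjoint and exhaust
  the target by mass balance, so the image of \<open>E\<close> is a Borel set up to a null set.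
\<close>

section \<open>Almost every target point is imaged once\<close>

text \<open>Infinitely many small translates of a bounded piece of \<open>A\<close> are pairwise
  disjoint, have equal measure and lie in one ball, so the piece must have measure zero.\<close>

lemma null_if_disjoint_translates:
  fixes A :: "'a::euclidean_space set"
  assumes A: "A \<in> sets borel" and "\<delta> > 0"
    and disj: "\<And>x s. x \<in> A \<Longrightarrow> 0 < s \<Longrightarrow> s < \<delta> \<Longrightarrow> x + s *\<^sub>R v \<notin> A"
  shows "A \<in> null_sets lborel"
proof -
  define B where "B r = A \<inter> ball 0 (real r)" for r :: nat
  have Bs: "B r \<in> sets borel" for r
    using A unfolding B_def by auto
  have "emeasure lborel (B r) = 0" for r
  proof -
    \<comment> \<open>The shifts \<open>\<delta> / (real k + 2)\<close> are distinct positive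
      numbers up to \<open>\<delta> / 2\<close>, so any two differ by an amount strictly between 0
      and \<open>\<delta>\<close>, as \<open>disj\<close> requires.\<close>
    define T where "T k = {x. (\<delta> / (real k + 2)) *\<^sub>R v + x \<in> B r}" for k :: nat
    have Ts: "T k \<in> sets borel" for k
      unfolding T_def using Bs[of r] by measurable
    have Te: "emeasure lborel (T k) = emeasure lborel (B r)" for k
    proof -
      have "emeasure lborel (B r) = emeasure (distr lborel borel ((+) ((\<delta> / (real k + 2)) *\<^sub>R v))) (B r)"
        by (simp add: lborel_distr_plus)
      also have "\<dots> = emeasure lborel (T k)"
        using Bs[of r] by (subst emeasure_distr) (auto simp: T_def vimage_def)
      finally show ?thesis by simp
    qed
    have dT: "T j \<inter> T k = {}" if "j < k" for j k
    proof -
      have *: "0 < \<delta> / (real j + 2) - \<delta> / (real k + 2)"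
        using that \<open>\<delta> > 0\<close> by (simp add: divide_strict_left_mono)
      have "\<delta> / (real j + 2) \<le> \<delta> / 2" "0 < \<delta> / (real k + 2)"
        using \<open>\<delta> > 0\<close> by (auto simp: field_simps)
      then have **: "\<delta> / (real j + 2) - \<delta> / (real k + 2) < \<delta>"
        using \<open>\<delta> > 0\<close> by linarith
      show ?thesis
      proof (rule ccontr)
        assume "\<not> ?thesis"
        then obtain x where "x \<in> T j" "x \<in> T k" by auto
        then have 1: "(\<delta> / (real k + 2)) *\<^sub>R v + x \<in> A" and 2: "(\<delta> / (real j + 2)) *\<^sub>R v + x \<in> A"
          by (auto simp: T_def B_def)
        from disj[OF 1 * **] 2 show False
          by (simp add: algebra_simps)
      qed
    qed
    have "disjoint_family T"
      unfolding disjoint_family_on_def using dT by (metis inf_commute nat_neq_iff)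
    then have sum: "(\<Sum>k. emeasure lborel (T k)) = emeasure lborel (\<Union>k. T k)"
      using Ts by (intro suminf_emeasure) auto
    have "(\<Union>k. T k) \<subseteq> ball 0 (real r + \<delta> * norm v)"
    proof clarify
      fix x k assume "x \<in> T k"
      then have *: "norm ((\<delta> / (real k + 2)) *\<^sub>R v + x) < real r" by (simp add: T_def B_def)
      have "norm x \<le> norm ((\<delta> / (real k + 2)) *\<^sub>R v + x) + norm ((\<delta> / (real k + 2)) *\<^sub>R v)"
        by (metis add_diff_cancel_left' norm_triangle_ineq4)
      also have "norm ((\<delta> / (real k + 2)) *\<^sub>R v) \<le> \<delta> * norm v"
        using \<open>\<delta> > 0\<close> by (auto simp: field_simps intro!: mult_right_mono)
      finally show "x \<in> ball 0 (real r + \<delta> * norm v)" using * by simp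
    qed
    then have "emeasure lborel (\<Union>k. T k) \<le> emeasure lborel (ball (0::'a) (real r + \<delta> * norm v))"
      by (intro emeasure_mono) auto
    also have "\<dots> < \<infinity>" by (rule emeasure_lborel_ball_finite)
    finally have fin: "(\<Sum>k::nat. emeasure lborel (B r)) < top"
      using sum Te by simp
    \<comment> \<open>A constant series with finite sum has zero terms: its sum dominates
      \<open>of_nat n\<close> times the term for every \<open>n\<close>, and these multiples have
      infinite supremum if the term is positive.\<close>
    have "(SUP n::nat. of_nat n) * emeasure lborel (B r) = (SUP n. of_nat n * emeasure lborel (B r))"
      by (rule SUP_mult_right_ennreal)
    also have "\<dots> \<le> (\<Sum>k::nat. emeasure lborel (B r))"
    proof (rule SUP_least)
      fix n :: nat
      show "of_nat n * emeasure lborel (B r) \<le> (\<Sum>k::nat. emeasure lborel (B r))"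
        using sum_le_suminf[of "\<lambda>k::nat. emeasure lborel (B r)" "{..<n}"] by simp
    qed
    finally show ?thesis
      using fin by (auto simp: ennreal_SUP_of_nat_eq_top ennreal_top_mult split: if_splits)
  qed
  then have "(\<Union>r. B r) \<in> null_sets lborel"
    using Bs by (intro null_sets_UN) auto
  moreover have "(\<Union>r. B r) = A"
    using reals_Archimedean2 by (auto simp: B_def)
  ultimately show ?thesis by simp
qed

text \<open>At a corner the left slope is smaller than the right slope. For fixed rational separating slopes
  and fixed \<open>\<delta>\<close>, two corners on a line parallel to \<open>v\<close> are at least \<open>\<delta>\<close> apart.\<close>

lemma null_corners:
  fixes \<beta> :: "'a::euclidean_space \<Rightarrow> real"
  assumes cont: "continuous_on UNIV \<beta>"
  shows "{z. \<exists>p q \<delta>. p < q \<and> \<delta> > 0 \<and>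
            (\<forall>s. 0 < s \<longrightarrow> s < \<delta> \<longrightarrow> \<beta> z - p * s \<le> \<beta> (z - s *\<^sub>R v) \<and> \<beta> z + q * s \<le> \<beta> (z + s *\<^sub>R v))}
         \<in> null_sets lborel" (is "?N \<in> _")
proof -
  define C where "C p q n = {z. \<forall>s\<in>{0<..<inverse (real (Suc n))}.
      \<beta> z - p * s \<le> \<beta> (z - s *\<^sub>R v) \<and> \<beta> z + q * s \<le> \<beta> (z + s *\<^sub>R v)}" for p q n
  have cont': "continuous_on UNIV (\<lambda>z. \<beta> (g z))" if "continuous_on UNIV g" for g :: "'a \<Rightarrow> 'a"
    using continuous_on_compose2[OF cont that] by auto
  \<comment> \<open>For fixed \<open>s\<close> both inequalities are closed conditions on
    \<open>z\<close>, because \<open>\<beta>\<close> is continuous; intersecting over all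
    \<open>s\<close> preserves closedness. What matters is Borel measurability.\<close>
  have "closed (C p q n)" for p q n
    unfolding C_def Ball_def
    by (intro closed_Collect_all closed_Collect_imp closed_Collect_conj closed_Collect_le
        continuous_intros cont' open_Collect_const)
  then have Cs: "C p q n \<in> sets borel" for p q n by auto
  have null: "C p q n \<in> null_sets lborel" if "p < q" for p q n
  proof (rule null_if_disjoint_translates[where v = v, OF Cs])
    show "0 < inverse (real (Suc n))" by simp
    fix x s assume x: "x \<in> C p q n" and s: "0 < s" "s < inverse (real (Suc n))"
    show "x + s *\<^sub>R v \<notin> C p q n"
    proof
      \<comment> \<open>Both slopes are tested on the same segment: the left condition at its far
        end bounds the increment of \<open>\<beta>\<close> above by \<open>p * s\<close>, the right
        condition at \<open>x\<close> bounds it below by \<open>q * s\<close>.\<close>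
      assume "x + s *\<^sub>R v \<in> C p q n"
      then have "\<beta> (x + s *\<^sub>R v) - p * s \<le> \<beta> (x + s *\<^sub>R v - s *\<^sub>R v) \<and>
          \<beta> (x + s *\<^sub>R v) + q * s \<le> \<beta> (x + s *\<^sub>R v + s *\<^sub>R v)"
        unfolding C_def mem_Collect_eq by (rule bspec) (use s in auto)
      moreover have "\<beta> x + q * s \<le> \<beta> (x + s *\<^sub>R v)" using s x by (auto simp: C_def)
      ultimately have "q * s \<le> p * s" by simp
      with s that show False by simp
    qed
  qed
  have "?N \<subseteq> (\<Union>p\<in>\<rat>. \<Union>q\<in>\<rat> \<inter> {p<..}. \<Union>n. C p q n)"
  proof clarify
    fix z p q \<delta> assume pq: "p < (q::real)" and "\<delta> > (0::real)"
      and corner: "\<forall>s. 0 < s \<longrightarrow> s < \<delta> \<longrightarrow> \<beta> z - p * s \<le> \<beta> (z - s *\<^sub>R v) \<and> \<beta> z + q * s \<le> \<beta> (z + s *\<^sub>R v)"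
    \<comment> \<open>Rational slopes between \<open>p\<close> and \<open>q\<close> weaken both
      inequalities, as \<open>s\<close> is positive, and leave only countably many sets.\<close>
    obtain p' where p': "p' \<in> \<rat>" "p < p'" "p' < q" using Rats_dense_in_real[OF pq] by auto
    obtain q' where q': "q' \<in> \<rat>" "p' < q'" "q' < q" using Rats_dense_in_real[OF p'(3)] by auto
    obtain n where n: "inverse (real (Suc n)) < \<delta>" using reals_Archimedean[OF \<open>\<delta> > 0\<close>] by auto
    have "z \<in> C p' q' n"
      unfolding C_def
    proof clarify
      fix s assume s: "s \<in> {0<..<inverse (real (Suc n))}"
      then have *: "\<beta> z - p * s \<le> \<beta> (z - s *\<^sub>R v)" "\<beta> z + q * s \<le> \<beta> (z + s *\<^sub>R v)"
        using corner n by auto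
      have "p * s \<le> p' * s" "q' * s \<le> q * s"
        using s p' q' by (auto intro!: mult_right_mono)
      with * show "\<beta> z - p' * s \<le> \<beta> (z - s *\<^sub>R v) \<and> \<beta> z + q' * s \<le> \<beta> (z + s *\<^sub>R v)"
        by linarith
    qed
    then show "z \<in> (\<Union>p\<in>\<rat>. \<Union>q\<in>\<rat> \<inter> {p<..}. \<Union>n. C p q n)" using p' q' by auto
  qed
  \<comment> \<open>\<open>lborel\<close> is not complete, so lying inside a null set would not
    suffice; equality with the countable union makes \<open>?N\<close> measurable as well.\<close>
  moreover have "C p q n \<subseteq> ?N" if "p < q" for p q n
  proof
    fix z assume "z \<in> C p q n"
    then show "z \<in> ?N"
      using that
      by (intro CollectI exI[of _ p] exI[of _ q] exI[of _ "inverse (real (Suc n))"]) (auto simp: C_def)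
  qed
  then have "(\<Union>p\<in>\<rat>. \<Union>q\<in>\<rat> \<inter> {p<..}. \<Union>n. C p q n) \<subseteq> ?N"
    by (intro UN_least) auto
  ultimately have "?N = (\<Union>p\<in>\<rat>. \<Union>q\<in>\<rat> \<inter> {p<..}. \<Union>n. C p q n)"
    by (rule subset_antisym)
  also have "\<dots> \<in> null_sets lborel"
    by (intro null_sets_UN' null countable_Int1 countable_rat countableI_type) auto
  finally show ?thesis .
qed

section \<open>The maximal path length as a function of the target point\<close>

lemma bdd_above_norm_add_dist:
  fixes \<Gamma> :: "'b::real_normed_vector set"
  assumes "bounded \<Gamma>"
  shows "bdd_above ((\<lambda>M. norm M + c * norm (M - P)) ` \<Gamma>)"
proof -
  obtain B where B: "\<And>M. M \<in> \<Gamma> \<Longrightarrow> norm M \<le> B" using assms by (auto simp: bounded_iff)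
  have "norm M + c * norm (M - P) \<le> B + \<bar>c\<bar> * (B + norm P)" if "M \<in> \<Gamma>" for M
  proof -
    have "norm (M - P) \<le> B + norm P" using norm_triangle_ineq4[of M P] B[OF that] by linarith
    then have "\<bar>c\<bar> * norm (M - P) \<le> \<bar>c\<bar> * (B + norm P)" by (intro mult_left_mono) auto
    moreover have "c * norm (M - P) \<le> \<bar>c\<bar> * norm (M - P)" by (intro mult_right_mono) auto
    ultimately show ?thesis using B[OF that] by linarith
  qed
  then show ?thesis by (rule bdd_aboveI2)
qed

text \<open>Each path length is \<open>c\<close>-Lipschitz in \<open>P\<close>, and a finite
  supremum of such functions is again \<open>c\<close>-Lipschitz; boundedness of
  \<open>\<Gamma>\<close> makes it finite.\<close>

lemma continuous_SUP_norm_add_dist: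
  fixes \<Gamma> :: "'b::real_normed_vector set"
  assumes bdd: "bounded \<Gamma>" and ne: "\<Gamma> \<noteq> {}" and c: "c \<ge> 0"
  shows "continuous_on UNIV (\<lambda>P. SUP M\<in>\<Gamma>. norm M + c * norm (M - P))" (is "continuous_on UNIV ?B")
proof -
  have le: "?B P \<le> ?B Q + c * norm (P - Q)" for P Q
  proof (rule cSUP_least[OF ne])
    fix M assume M: "M \<in> \<Gamma>"
    have "norm (M - P) \<le> norm (M - Q) + norm (P - Q)"
      using norm_triangle_ineq4[of "M - Q" "P - Q"] by simp
    then have "c * norm (M - P) \<le> c * (norm (M - Q) + norm (P - Q))"
      using c by (rule mult_left_mono)
    moreover have "norm M + c * norm (M - Q) \<le> ?B Q"
      using M bdd_above_norm_add_dist[OF bdd] by (rule cSUP_upper)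
    ultimately show "norm M + c * norm (M - P) \<le> ?B Q + c * norm (P - Q)"
      by (simp add: algebra_simps)
  qed
  have "c-lipschitz_on UNIV ?B"
  proof (rule lipschitz_onI[OF _ c])
    fix P Q :: 'b
    show "dist (?B P) (?B Q) \<le> c * dist P Q"
      using le[of P Q] le[of Q P] by (auto simp: dist_norm norm_minus_commute abs_le_iff)
  qed
  then show ?thesis by (rule lipschitz_on_continuous_on)
qed

section \<open>Recovering the contact point from the slopes\<close>

text \<open>Chain rule: the differential of the distance to \<open>M\<close> is the inner product
  with the unit vector \<open>Y\<close>, and the curve on the graph has velocity \<open>v\<close> in
  the base and the derivative of \<open>\<phi>\<close> along \<open>v\<close> in height.\<close>

lemma real_derivative_norm_along_graph:
  fixes \<phi> :: "'a::euclidean_space \<Rightarrow> real"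
  assumes "\<phi> differentiable at z" and ne: "M \<noteq> (z, \<phi> z)"
  defines "Y \<equiv> sgn ((z, \<phi> z) - M)"
  shows "((\<lambda>t. norm (M - (z + t *\<^sub>R v, \<phi> (z + t *\<^sub>R v)))) has_real_derivative
           fst Y \<bullet> v + snd Y * frechet_derivative \<phi> (at z) v) (at 0)"
proof -
  let ?D = "frechet_derivative \<phi> (at z)"
  have D: "(\<phi> has_derivative ?D) (at (z + 0 *\<^sub>R v))"
    using assms(1) frechet_derivative_works by force
  have "((\<lambda>t. z + t *\<^sub>R v) has_derivative (\<lambda>t. t *\<^sub>R v)) (at 0)"
    by (auto intro!: derivative_eq_intros)
  from has_derivative_compose[OF this D]
  have "((\<lambda>t. \<phi> (z + t *\<^sub>R v)) has_derivative (\<lambda>t. ?D (t *\<^sub>R v))) (at 0)" .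
  then have 1: "((\<lambda>t. M - (z + t *\<^sub>R v, \<phi> (z + t *\<^sub>R v))) has_derivative
      (\<lambda>t. - (t *\<^sub>R v, ?D (t *\<^sub>R v)))) (at 0)"
    by (auto intro!: derivative_eq_intros)
  have ne': "M - (z, \<phi> z) \<noteq> 0" using ne by simp
  have 2: "(norm has_derivative (\<lambda>h. h \<bullet> sgn (M - (z, \<phi> z)))) (at (M - (z + 0 *\<^sub>R v, \<phi> (z + 0 *\<^sub>R v))))"
    using has_derivative_norm[OF ne'] by simp
  have lin: "linear ?D" using linear_frechet_derivative[OF assms(1)] .
  have Y: "sgn (M - (z, \<phi> z)) = - Y"
    unfolding Y_def by (metis minus_diff_eq sgn_minus)
  have "((\<lambda>t. norm (M - (z + t *\<^sub>R v, \<phi> (z + t *\<^sub>R v)))) has_derivative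
      (\<lambda>t. (- (t *\<^sub>R v, ?D (t *\<^sub>R v))) \<bullet> (- Y))) (at 0)"
    using has_derivative_compose[OF 1 2] Y by simp
  moreover have "(\<lambda>t. (- (t *\<^sub>R v, ?D (t *\<^sub>R v))) \<bullet> (- Y)) =
      (*) (fst Y \<bullet> v + snd Y * ?D v)"
    by (cases Y) (auto simp: linear_scale[OF lin] algebra_simps inner_commute)
  ultimately show ?thesis by (simp only: has_field_derivative_def)
qed

text \<open>Two unit vectors with the same tangential part are equal or mirror images in the tangent
  plane, and the inequalities in \<open>pos\<close> put both on the same side of it.\<close>

lemma unit_vector_determined_by_tangential_part:
  fixes Y\<^sub>1 Y\<^sub>2 :: "'a::real_inner \<times> real"
  assumes lin: "linear D" and "norm Y\<^sub>1 = 1" "norm Y\<^sub>2 = 1"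
    and pos: "D (fst Y\<^sub>1) < snd Y\<^sub>1" "D (fst Y\<^sub>2) < snd Y\<^sub>2"
    and tan: "\<And>v. fst Y\<^sub>1 \<bullet> v + snd Y\<^sub>1 * D v = fst Y\<^sub>2 \<bullet> v + snd Y\<^sub>2 * D v"
  shows "Y\<^sub>1 = Y\<^sub>2"
proof -
  define a where "a = fst Y\<^sub>1 - fst Y\<^sub>2"
  define c where "c = snd Y\<^sub>1 - snd Y\<^sub>2"
  define w where "w = fst Y\<^sub>1 + fst Y\<^sub>2"
  have ac: "a \<bullet> v = - c * D v" for v
    using tan[of v] by (simp add: a_def c_def algebra_simps inner_diff_left)
  have "Y\<^sub>1 \<bullet> Y\<^sub>1 = Y\<^sub>2 \<bullet> Y\<^sub>2" using assms(2,3) by (simp add: norm_eq_1)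
  \<comment> \<open>Equal norms make the difference of the vectors orthogonal to their sum.
    Substituting \<open>ac\<close> turns this into \<open>c\<close> times a sum of two positive
    numbers.\<close>
  then have "a \<bullet> w + c * (snd Y\<^sub>1 + snd Y\<^sub>2) = 0"
    by (cases Y\<^sub>1; cases Y\<^sub>2)
      (simp add: a_def w_def c_def inner_diff_left inner_add_right inner_commute algebra_simps)
  then have "c * (snd Y\<^sub>1 - D (fst Y\<^sub>1) + (snd Y\<^sub>2 - D (fst Y\<^sub>2))) = 0"
    by (simp add: ac w_def linear_add[OF lin] algebra_simps)
  then have "c = 0" using pos by simp
  then have "a = 0" using ac[of a] by simp
  with \<open>c = 0\<close> show ?thesis by (simp add: a_def c_def prod_eq_iff)
qed

text \<open>Moving backwards from \<open>P\<close> along the common ray at unit speed, \<open>c * norm (M - P)\<close> grows at rate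
  \<open>c > 1\<close>, whereas \<open>norm M\<close> decreases at rate at most \<open>1\<close>.\<close>

lemma oval_point_determined_by_direction:
  fixes P :: "'b::real_inner"
  assumes c: "1 < c" and dir: "sgn (P - M\<^sub>1) = sgn (P - M\<^sub>2)"
    and eq: "norm M\<^sub>1 + c * norm (M\<^sub>1 - P) = norm M\<^sub>2 + c * norm (M\<^sub>2 - P)"
  shows "M\<^sub>1 = M\<^sub>2"
proof -
  define s\<^sub>1 where "s\<^sub>1 = norm (P - M\<^sub>1)"
  define s\<^sub>2 where "s\<^sub>2 = norm (P - M\<^sub>2)"
  define u where "u = sgn (P - M\<^sub>2)"
  have PM: "P - M = norm (P - M) *\<^sub>R sgn (P - M)" for M :: 'b
    by (cases "P = M") (auto simp: sgn_div_norm)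
  have "M\<^sub>1 - M\<^sub>2 = (P - M\<^sub>2) - (P - M\<^sub>1)" by simp
  also have "\<dots> = s\<^sub>2 *\<^sub>R u - s\<^sub>1 *\<^sub>R u"
    using PM[of M\<^sub>1] PM[of M\<^sub>2] dir by (simp add: s\<^sub>1_def s\<^sub>2_def u_def)
  also have "\<dots> = (s\<^sub>2 - s\<^sub>1) *\<^sub>R u" by (simp add: scaleR_diff_left)
  finally have M12: "M\<^sub>1 - M\<^sub>2 = (s\<^sub>2 - s\<^sub>1) *\<^sub>R u" .
  then have "norm (M\<^sub>1 - M\<^sub>2) \<le> \<bar>s\<^sub>2 - s\<^sub>1\<bar>"
    by (simp add: u_def norm_sgn)
  moreover have "norm M\<^sub>1 - norm M\<^sub>2 = c * (s\<^sub>2 - s\<^sub>1)"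
    using eq by (simp add: s\<^sub>1_def s\<^sub>2_def norm_minus_commute right_diff_distrib)
  then have "\<bar>norm M\<^sub>1 - norm M\<^sub>2\<bar> = c * \<bar>s\<^sub>2 - s\<^sub>1\<bar>"
    using c by (simp add: abs_mult)
  ultimately have "c * \<bar>s\<^sub>2 - s\<^sub>1\<bar> \<le> 1 * \<bar>s\<^sub>2 - s\<^sub>1\<bar>"
    using norm_triangle_ineq3[of M\<^sub>1 M\<^sub>2] by simp
  then have "s\<^sub>2 = s\<^sub>1"
    using c by (subst (asm) mult_le_cancel_right) auto
  with M12 show ?thesis by simp
qed

text \<open>\<open>contact z M\<close> says that \<open>M\<close> maximises the path length to the
  graph point over \<open>z\<close> and lies strictly below the tangent plane there. Two contact
  points with different slopes produce a corner of the maximum; with equal slopes they coincide.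
  Enclosing the bad set in a null set avoids the question of its measurability.\<close>

lemma null_multiply_covered:
  fixes \<phi> :: "'a::euclidean_space \<Rightarrow> real" and \<Gamma> :: "('a \<times> real) set"
  assumes diff: "\<And>z. \<phi> differentiable at z" and bdd: "bounded \<Gamma>" and c: "1 < c"
  defines "contact z M \<equiv> M \<in> \<Gamma> \<and> M \<noteq> (z, \<phi> z) \<and>
      (\<forall>M'\<in>\<Gamma>. norm M' + c * norm (M' - (z, \<phi> z)) \<le> norm M + c * norm (M - (z, \<phi> z))) \<and>
      frechet_derivative \<phi> (at z) (fst ((z, \<phi> z) - M)) < snd ((z, \<phi> z) - M)"
  shows "\<exists>N\<in>null_sets lborel. {z. \<exists>M\<^sub>1 M\<^sub>2. contact z M\<^sub>1 \<and> contact z M\<^sub>2 \<and> M\<^sub>1 \<noteq> M\<^sub>2} \<subseteq> N"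
proof (cases "\<Gamma> = {}")
  case True
  then show ?thesis by (intro bexI[of _ "{}"]) (auto simp: contact_def)
next
  case False
  define \<beta> where "\<beta> z = (SUP M\<in>\<Gamma>. norm M + c * norm (M - (z, \<phi> z)))" for z
  have "continuous_on UNIV \<phi>"
    using diff by (simp add: continuous_on_eq_continuous_at differentiable_imp_continuous_within)
  then have "continuous_on UNIV (\<lambda>z. (z, \<phi> z))" by (intro continuous_intros)
  then have cont: "continuous_on UNIV \<beta>"
    unfolding \<beta>_def
    using c by (intro continuous_on_compose2[OF continuous_SUP_norm_add_dist[OF bdd False]]) auto
  have \<beta>_ge: "norm M + c * norm (M - (z, \<phi> z)) \<le> \<beta> z" if "M \<in> \<Gamma>" for z M
    unfolding \<beta>_def using that bdd_above_norm_add_dist[OF bdd] by (rule cSUP_upper)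
  have \<beta>_eq: "\<beta> z = norm M + c * norm (M - (z, \<phi> z))" if "contact z M" for z M
  proof (rule antisym)
    show "\<beta> z \<le> norm M + c * norm (M - (z, \<phi> z))"
      unfolding \<beta>_def using that by (intro cSUP_least[OF False]) (auto simp: contact_def)
    show "norm M + c * norm (M - (z, \<phi> z)) \<le> \<beta> z"
      using that by (intro \<beta>_ge) (simp add: contact_def)
  qed
  define Y where "Y z M = sgn ((z, \<phi> z) - M)" for z M
  define slope where "slope z M v = fst (Y z M) \<bullet> v + snd (Y z M) * frechet_derivative \<phi> (at z) v"
    for z M v
  define N where "N v = {z. \<exists>p q \<delta>. p < q \<and> \<delta> > 0 \<and>
            (\<forall>s. 0 < s \<longrightarrow> s < \<delta> \<longrightarrow> \<beta> z - p * s \<le> \<beta> (z - s *\<^sub>R v) \<and> \<beta> z + q * s \<le> \<beta> (z + s *\<^sub>R v))}" for v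
  have corner: "z \<in> N v" if M1: "contact z M\<^sub>1" and M2: "contact z M\<^sub>2"
      and less: "slope z M\<^sub>1 v < slope z M\<^sub>2 v" for z v M\<^sub>1 M\<^sub>2
  proof -
    \<comment> \<open>\<open>h M\<close> touches \<open>\<beta>\<close> from below at parameter 0.
      The contact point with the smaller slope therefore controls \<open>\<beta>\<close> on the
      left, the one with the larger slope on the right.\<close>
    define h where "h M t = norm M + c * norm (M - (z + t *\<^sub>R v, \<phi> (z + t *\<^sub>R v)))" for M t
    have h: "(h M has_real_derivative c * slope z M v) (at 0)" if "contact z M" for M
    proof -
      have "((\<lambda>t. norm (M - (z + t *\<^sub>R v, \<phi> (z + t *\<^sub>R v)))) has_real_derivative slope z M v) (at 0)"
        unfolding slope_def Y_def
        using that by (intro real_derivative_norm_along_graph diff) (simp add: contact_def)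
      from DERIV_add[OF DERIV_const DERIV_cmult[OF this]] show ?thesis
        unfolding h_def by simp
    qed
    have h0: "h M 0 = \<beta> z" if "contact z M" for M
      using \<beta>_eq[OF that] by (simp add: h_def)
    have h_le: "h M t \<le> \<beta> (z + t *\<^sub>R v)" if "contact z M" for M t
      using \<beta>_ge[of M] that by (simp add: h_def contact_def)
    have "c * slope z M\<^sub>1 v < c * slope z M\<^sub>2 v" using less c by simp
    then obtain p where p: "c * slope z M\<^sub>1 v < p" "p < c * slope z M\<^sub>2 v" using dense by blast
    then obtain q where q: "p < q" "q < c * slope z M\<^sub>2 v" using dense by blast
    have "((\<lambda>t. h M\<^sub>1 t - p * t) has_real_derivative c * slope z M\<^sub>1 v - p) (at 0)"
      using h[OF M1] by (auto intro!: derivative_eq_intros)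
    from DERIV_neg_dec_left[OF this] p obtain d1 where d1: "d1 > 0"
      "\<And>s. 0 < s \<Longrightarrow> s < d1 \<Longrightarrow> h M\<^sub>1 0 < h M\<^sub>1 (- s) + p * s" by auto
    have "((\<lambda>t. h M\<^sub>2 t - q * t) has_real_derivative c * slope z M\<^sub>2 v - q) (at 0)"
      using h[OF M2] by (auto intro!: derivative_eq_intros)
    from DERIV_pos_inc_right[OF this] q obtain d2 where d2: "d2 > 0"
      "\<And>s. 0 < s \<Longrightarrow> s < d2 \<Longrightarrow> h M\<^sub>2 0 < h M\<^sub>2 s - q * s" by auto
    have "\<beta> z - p * s \<le> \<beta> (z - s *\<^sub>R v) \<and> \<beta> z + q * s \<le> \<beta> (z + s *\<^sub>R v)"
      if "0 < s" "s < min d1 d2" for s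
      using d1(2)[of s] d2(2)[of s] that h_le[OF M1, of "- s"] h_le[OF M2, of s] h0[OF M1] h0[OF M2]
      by simp
    then show ?thesis
      unfolding N_def using q d1(1) d2(1)
      by (intro CollectI exI[of _ p] exI[of _ q] exI[of _ "min d1 d2"]) auto
  qed
  have "(\<Union>v\<in>Basis. N v) \<in> null_sets lborel"
    unfolding N_def by (intro null_sets_UN' null_corners[OF cont] countable_finite finite_Basis)
  moreover have "z \<in> (\<Union>v\<in>Basis. N v)"
    if M1: "contact z M\<^sub>1" and M2: "contact z M\<^sub>2" and ne: "M\<^sub>1 \<noteq> M\<^sub>2" for z M\<^sub>1 M\<^sub>2
  proof (rule ccontr)
    assume "z \<notin> (\<Union>v\<in>Basis. N v)"
    \<comment> \<open>Off the corner sets neither slope can exceed the other on a basis vector. Both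
      are linear in the direction, so they agree in every direction.\<close>
    then have slopes: "slope z M\<^sub>1 v = slope z M\<^sub>2 v" if "v \<in> Basis" for v
      using corner[OF M1 M2, of v] corner[OF M2 M1, of v] that by (metis UN_I linorder_neqE_linordered_idom)
    let ?D = "frechet_derivative \<phi> (at z)"
    have lin: "linear ?D" using linear_frechet_derivative[OF diff] .
    have lin_slope: "linear (slope z M)" for M
      unfolding slope_def
      by (intro linearI) (auto simp: inner_add_right linear_add[OF lin] linear_scale[OF lin] algebra_simps)
    have eq: "slope z M\<^sub>1 = slope z M\<^sub>2"
      using lin_slope lin_slope slopes by (rule linear_eq_stdbasis)
    have tan: "fst (Y z M\<^sub>1) \<bullet> v + snd (Y z M\<^sub>1) * ?D v = fst (Y z M\<^sub>2) \<bullet> v + snd (Y z M\<^sub>2) * ?D v" for v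
      using fun_cong[OF eq, of v] unfolding slope_def .
    have pos: "?D (fst (Y z M)) < snd (Y z M)" and unit: "norm (Y z M) = 1" if "contact z M" for M
    proof -
      have ne0: "(z, \<phi> z) - M \<noteq> 0" and *: "?D (fst ((z, \<phi> z) - M)) < snd ((z, \<phi> z) - M)"
        using that by (auto simp: contact_def)
      then show "norm (Y z M) = 1" unfolding Y_def norm_sgn by (simp only: if_False)
      show "?D (fst (Y z M)) < snd (Y z M)"
        unfolding Y_def sgn_div_norm fst_scaleR snd_scaleR linear_scale[OF lin]
        using * ne0 by (simp only: real_scaleR_def) (rule mult_strict_left_mono, assumption, simp only: positive_imp_inverse_positive zero_less_norm_iff simp_thms)
    qed
    have "Y z M\<^sub>1 = Y z M\<^sub>2"
      by (rule unit_vector_determined_by_tangential_part[OF lin unit[OF M1] unit[OF M2] pos[OF M1] pos[OF M2] tan])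
    then have "M\<^sub>1 = M\<^sub>2"
      unfolding Y_def
      by (rule oval_point_determined_by_direction[OF c _ trans[OF \<beta>_eq[OF M1, symmetric] \<beta>_eq[OF M2]]])
    with ne show False by contradiction
  qed
  ultimately show ?thesis by (intro bexI[of _ "\<Union>v\<in>Basis. N v"]) auto
qed

section \<open>Measure preserving multivalued maps\<close>

text \<open>Abstract form of passing from preimages to images: \<open>M\<close> and \<open>N\<close>
  stand for the weighted source and target, \<open>R\<close> for the imaging map, and
  \<open>S\<close> contains the target points with several preimages. Mass is compared on preimages
  of Borel sets only; completeness of \<open>N\<close> serves for images, which are shown to be
  Borel up to null sets.\<close>

locale measure_preserving_multimap =
  M: finite_measure M + N: finite_measure N + N: complete_measure N
  for M :: "'a::metric_space measure"
    and N :: "'b::{metric_space, second_countable_topology} measure" +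
  fixes R :: "'a \<Rightarrow> 'b set" and S :: "'b set"
  assumes borel_M: "A \<in> sets borel \<Longrightarrow> A \<subseteq> space M \<Longrightarrow> A \<in> sets M"
    and borel_N: "G \<in> sets borel \<Longrightarrow> G \<subseteq> space N \<Longrightarrow> G \<in> sets N"
    and borel_space_N: "space N \<in> sets borel"
    and inner_regular: "A \<in> sets M \<Longrightarrow> e > 0 \<Longrightarrow> \<exists>K\<subseteq>A. compact K \<and> measure M A \<le> measure M K + e"
    and R_values: "X \<in> space M \<Longrightarrow> R X \<noteq> {} \<and> R X \<subseteq> space N"
    and vimage_sets: "G \<in> sets borel \<Longrightarrow> G \<subseteq> space N \<Longrightarrow> {X\<in>space M. R X \<inter> G \<noteq> {}} \<in> sets M"
    and measure_vimage: "G \<in> sets borel \<Longrightarrow> G \<subseteq> space N \<Longrightarrow>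
      measure M {X\<in>space M. R X \<inter> G \<noteq> {}} = measure N G"
    and S_borel: "S \<in> sets borel" and S_null: "S \<in> null_sets N"
    and injective: "X \<in> space M \<Longrightarrow> X' \<in> space M \<Longrightarrow> P \<in> R X \<Longrightarrow> P \<in> R X' \<Longrightarrow> P \<notin> S \<Longrightarrow> X = X'"
begin

definition mvimage :: "'b set \<Rightarrow> 'a set" where
  "mvimage G = {X\<in>space M. R X \<inter> G \<noteq> {}}"

text \<open>Off this set \<open>R\<close> is single-valued, and a point shares its image with no
  other point, since that image avoids \<open>S\<close>.\<close>

definition singular :: "'a set" where
  "singular = {X\<in>space M. \<exists>P\<in>R X. \<exists>Q\<in>R X. P \<noteq> Q} \<union> mvimage S"

lemma S_subset: "S \<subseteq> space N"
  using S_null sets.sets_into_space by blast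

text \<open>The measures of the two preimages add up to the measure of their union.\<close>

lemma null_mvimage_Int:
  assumes G: "G \<in> sets borel" "G \<subseteq> space N" and H: "H \<in> sets borel" "H \<subseteq> space N"
    and "G \<inter> H = {}"
  shows "mvimage G \<inter> mvimage H \<in> null_sets M"
proof -
  have s: "mvimage G \<in> sets M" "mvimage H \<in> sets M"
    using vimage_sets G H by (auto simp: mvimage_def)
  have "mvimage (G \<union> H) = mvimage G \<union> mvimage H" by (auto simp: mvimage_def)
  then have "measure M (mvimage G \<union> mvimage H) = measure N (G \<union> H)"
    using measure_vimage[of "G \<union> H"] G H by (simp add: mvimage_def)
  also have "\<dots> = measure N G + measure N H"
    using G H assms(5) by (intro N.finite_measure_Union borel_N)
  also have "\<dots> = measure M (mvimage G) + measure M (mvimage H)"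
    using measure_vimage G H by (simp add: mvimage_def)
  finally have "measure M (mvimage G \<inter> mvimage H) = 0"
    using M.finite_measure_Union'[OF s] M.finite_measure_Diff'[OF s(2,1)] by (simp add: Int_commute)
  then show ?thesis using s by (auto simp: null_sets_def M.emeasure_eq_measure)
qed

text \<open>Distinct images of one point are separated by disjoint members of a countable basis, so
  the points with several images form a countable union of the null sets from
  \<open>null_mvimage_Int\<close>. The preimage of \<open>S\<close> has the measure of
  \<open>S\<close>, which is zero.\<close>

lemma singular_null: "singular \<in> null_sets M"
proof -
  obtain \<B> :: "'b set set" where \<B>: "countable \<B>" "topological_basis \<B>"
    using ex_countable_basis by blast
  have borel: "B \<inter> space N \<in> sets borel" if "B \<in> \<B>" for B
    using topological_basis_open[OF \<B>(2) that] by (rule sets.Int[OF borel_open borel_space_N])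
  define T where "T B C = mvimage (B \<inter> space N) \<inter> mvimage (C \<inter> space N)" for B C
  have T: "X \<in> T B C \<longleftrightarrow> X \<in> space M \<and> R X \<inter> B \<noteq> {} \<and> R X \<inter> C \<noteq> {}" for X B C
    using R_values[of X] unfolding T_def mvimage_def by blast
  have "(\<Union>B\<in>\<B>. \<Union>C\<in>{C\<in>\<B>. B \<inter> C = {}}. T B C) \<in> null_sets M"
  proof (intro null_sets_UN')
    show "T B C \<in> null_sets M" if "B \<in> \<B>" "C \<in> {C\<in>\<B>. B \<inter> C = {}}" for B C
    proof -
      have "B \<inter> space N \<inter> (C \<inter> space N) = {}" using that(2) by blast
      then show ?thesis
        using that borel unfolding T_def by (intro null_mvimage_Int) simp_all
    qed
    show "countable {C\<in>\<B>. B \<inter> C = {}}" for B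
      using \<B>(1) by simp
  qed fact
  also have "(\<Union>B\<in>\<B>. \<Union>C\<in>{C\<in>\<B>. B \<inter> C = {}}. T B C) =
      {X\<in>space M. \<exists>P\<in>R X. \<exists>Q\<in>R X. P \<noteq> Q}" (is "?R = ?L")
  proof (rule subset_antisym[OF subsetI subsetI, rotated])
    fix X assume "X \<in> ?L"
    then obtain P Q where X: "X \<in> space M" "P \<in> R X" "Q \<in> R X" "P \<noteq> Q" by blast
    obtain G H where GH: "open G" "open H" "P \<in> G" "Q \<in> H" "G \<inter> H = {}"
      using hausdorff[OF X(4)] by (elim exE conjE)
    obtain B where B: "B \<in> \<B>" "P \<in> B" "B \<subseteq> G"
      by (rule topological_basisE[OF \<B>(2) GH(1,3)])
    obtain C where C: "C \<in> \<B>" "Q \<in> C" "C \<subseteq> H"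
      by (rule topological_basisE[OF \<B>(2) GH(2,4)])
    have "R X \<inter> B \<noteq> {}" "R X \<inter> C \<noteq> {}" using X(2,3) B(2) C(2) by auto
    then have "X \<in> T B C" using X(1) by (simp only: T simp_thms)
    moreover have "B \<inter> C = {}" using B(3) C(3) GH(5) by auto
    ultimately show "X \<in> ?R" using B(1) C(1) by (intro UN_I CollectI conjI)
  next
    fix X assume "X \<in> ?R"
    then obtain B C where BC: "B \<inter> C = {}" and "X \<in> T B C" by (elim UN_E CollectE conjE)
    then have X: "X \<in> space M" "R X \<inter> B \<noteq> {}" "R X \<inter> C \<noteq> {}" unfolding T by simp_all
    then obtain P Q where "P \<in> R X" "P \<in> B" "Q \<in> R X" "Q \<in> C" by auto
    moreover from this BC have "P \<noteq> Q" by auto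
    ultimately show "X \<in> ?L" using X(1) by auto
  qed
  finally have "{X\<in>space M. \<exists>P\<in>R X. \<exists>Q\<in>R X. P \<noteq> Q} \<in> null_sets M" .
  moreover have "mvimage S \<in> null_sets M"
  proof (rule null_setsI)
    show sets: "mvimage S \<in> sets M"
      using vimage_sets[OF S_borel S_subset] by (simp only: mvimage_def)
    have "measure N S = 0" using S_null by (simp add: measure_def null_setsD1)
    then show "emeasure M (mvimage S) = 0"
      using measure_vimage[OF S_borel S_subset] by (simp add: M.emeasure_eq_measure mvimage_def)
  qed
  ultimately show ?thesis unfolding singular_def by (rule null_sets.Un)
qed

lemma nonsingular_unique:
  assumes "X \<in> space M - singular" "P \<in> R X" "Q \<in> R X"
  shows "P = Q"
  using assms by (auto simp: singular_def)

text \<open>A point sharing an image with a nonsingular point equals it. Hence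
  \<open>measure_vimage\<close>, an identity about preimages, also computes the measure of the image
  of a nonsingular set once that image is Borel.\<close>

lemma mvimage_image:
  assumes "A \<subseteq> space M - singular"
  shows "mvimage (\<Union>X\<in>A. R X) = A"
proof (intro equalityI subsetI)
  fix X assume "X \<in> A"
  then show "X \<in> mvimage (\<Union>X\<in>A. R X)" using assms R_values[of X] by (auto simp: mvimage_def)
next
  fix X assume "X \<in> mvimage (\<Union>X\<in>A. R X)"
  then obtain P X' where *: "X \<in> space M" "P \<in> R X" "X' \<in> A" "P \<in> R X'" by (auto simp: mvimage_def)
  have "X' \<in> space M" "P \<notin> S" using assms * by (auto simp: singular_def mvimage_def)
  then have "X = X'" using * injective by blast
  then show "X \<in> A" using * by simp
qed

text \<open>Lusin's theorem for the almost everywhere single-valued map \<open>R\<close>: it is continuous on a compact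
  set of almost full measure, since each set of a countable basis has a preimage that is closed and
  open relative to that compact set.\<close>

lemma ex_compact_with_compact_image:
  assumes A: "A \<in> sets M" "A \<subseteq> space M - singular" and e: "e > 0"
  shows "\<exists>K\<subseteq>A. compact K \<and> compact (\<Union>X\<in>K. R X) \<and> measure M A \<le> measure M K + e"
proof -
  obtain B :: "nat \<Rightarrow> 'b set" where B: "topological_basis (range B)"
  proof -
    obtain \<B> :: "'b set set" where \<B>: "countable \<B>" "topological_basis \<B>"
      using ex_countable_basis by blast
    have "\<B> \<noteq> {}" using \<B>(2) topological_basisE[OF \<B>(2) open_UNIV UNIV_I] by blast
    then show ?thesis using that[of "from_nat_into \<B>"] \<B> by (simp add: range_from_nat_into)
  qed
  define L where "L n = mvimage (B n \<inter> space N)" for n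
  have Ls: "L n \<in> sets M" for n
    using vimage_sets[of "B n \<inter> space N"] topological_basis_open[OF B] borel_space_N
    by (auto simp: L_def mvimage_def)
  \<comment> \<open>Each \<open>n\<close> costs at most \<open>2 * d n\<close>, once inside and once
    outside \<open>L n\<close>, and these costs sum to \<open>e\<close>.\<close>
  define d where "d n = e / 2 * (1/2) ^ Suc n" for n :: nat
  have d: "d n > 0" for n using e by (simp add: d_def)
  have "\<exists>K\<subseteq>A \<inter> L n. compact K \<and> measure M (A \<inter> L n) \<le> measure M K + d n" for n
    using inner_regular[OF sets.Int[OF A(1) Ls] d] .
  then obtain C where C: "\<And>n. C n \<subseteq> A \<inter> L n" "\<And>n. compact (C n)"
      "\<And>n. measure M (A \<inter> L n) \<le> measure M (C n) + d n"
    by metis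
  have "\<exists>K\<subseteq>A - L n. compact K \<and> measure M (A - L n) \<le> measure M K + d n" for n
    using inner_regular[OF sets.Diff[OF A(1) Ls] d] .
  then obtain C' where C': "\<And>n. C' n \<subseteq> A - L n" "\<And>n. compact (C' n)"
      "\<And>n. measure M (A - L n) \<le> measure M (C' n) + d n"
    by metis
  have AM: "A \<subseteq> space M" using A by auto
  have Cs: "C n \<in> sets M" "C' n \<in> sets M" for n
    using C(1)[of n] C'(1)[of n] C(2) C'(2) AM by (auto intro!: borel_M borel_compact)
  \<comment> \<open>On \<open>K\<close> membership in \<open>L n\<close> is decided by closed sets:
    points of \<open>C n\<close> lie inside, points of \<open>C' n\<close> outside.\<close>
  define K where "K = (\<Inter>n. C n \<union> C' n)"
  have K: "compact K"
  proof -
    have "closed (C n \<union> C' n)" for n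
      using C(2) C'(2) by (intro closed_Un compact_imp_closed)
    then have "closed K" unfolding K_def by (intro closed_INT) auto
    moreover have "compact (C 0 \<union> C' 0)" using C(2) C'(2) by (rule compact_Un)
    ultimately have "compact ((C 0 \<union> C' 0) \<inter> K)" by (intro compact_Int_closed)
    also have "(C 0 \<union> C' 0) \<inter> K = K" unfolding K_def by blast
    finally show ?thesis .
  qed
  have KA: "K \<subseteq> A" unfolding K_def using C(1) C'(1) by blast
  have Ks: "K \<in> sets M" using K KA AM by (intro borel_M borel_compact) auto
  have small: "measure M (A - (C n \<union> C' n)) \<le> 2 * d n" for n
  proof -
    have "measure M (A - (C n \<union> C' n)) = measure M A - measure M (C n \<union> C' n)"
    proof (rule M.finite_measure_Diff[OF A(1)])
      show "C n \<union> C' n \<in> sets M" using Cs by (rule sets.Un)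
      show "C n \<union> C' n \<subseteq> A" using C(1)[of n] C'(1)[of n] by auto
    qed
    also have "measure M (C n \<union> C' n) = measure M (C n) + measure M (C' n)"
      using Cs C(1)[of n] C'(1)[of n] by (intro M.finite_measure_Union) auto
    also have "measure M A = measure M (A \<inter> L n) + measure M (A - L n)"
      using A(1) Ls M.finite_measure_Union[of "A \<inter> L n" "A - L n"]
      by (simp add: Int_Diff_Un Int_Diff_disjoint sets.Int sets.Diff)
    finally show ?thesis using C(3)[of n] C'(3)[of n] by linarith
  qed
  have sums: "(\<lambda>n. 2 * d n) sums e"
    using sums_mult[OF power_half_series, of e] by (simp add: d_def)
  have summable_d: "summable (\<lambda>n. measure M (A - (C n \<union> C' n)))"
    by (rule summable_comparison_test'[OF sums_summable[OF sums], of 0]) (simp add: small)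
  have "measure M (A - K) \<le> e"
  proof -
    have "measure M (\<Union>n. A - (C n \<union> C' n)) \<le> (\<Sum>n. measure M (A - (C n \<union> C' n)))"
      using A Cs sums small
      by (intro M.finite_measure_subadditive_countably)
        (auto intro!: summable_d)
    also have "\<dots> \<le> (\<Sum>n. 2 * d n)"
      using sums small
      by (intro suminf_le summable_d sums_summable[OF sums])
    finally show ?thesis using sums_unique[OF sums] by (simp add: K_def)
  qed
  moreover have "measure M (A - K) = measure M A - measure M K"
    using A(1) Ks KA by (intro M.finite_measure_Diff)
  ultimately have meas: "measure M A \<le> measure M K + e" by linarith
  define t where "t X = (SOME P. P \<in> R X)" for X
  have t: "R X = {t X}" if "X \<in> K" for X
  proof -
    have X: "X \<in> space M - singular" using that KA A(2) by auto
    then have "t X \<in> R X" using R_values[of X] unfolding t_def by (simp add: some_in_eq)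
    then show ?thesis using nonsingular_unique[OF X] by blast
  qed
  have "continuous_on K t"
  proof (rule continuous_on_open_invariant[THEN iffD2], intro allI impI)
    fix G :: "'b set" assume G: "open G"
    define I where "I = {n. B n \<subseteq> G}"
    have GI: "G = (\<Union>n\<in>I. B n)"
    proof (intro equalityI subsetI)
      fix P assume "P \<in> G"
      from topological_basisE[OF B G this] show "P \<in> (\<Union>n\<in>I. B n)" by (auto simp: I_def)
    qed (auto simp: I_def)
    have basic: "- C' n \<inter> K = t -` B n \<inter> K" for n
    proof (intro equalityI subsetI)
      fix X assume X: "X \<in> - C' n \<inter> K"
      then have "X \<in> C n" by (auto simp: K_def)
      then have "X \<in> L n" using C(1) by blast
      then show "X \<in> t -` B n \<inter> K" using t X by (auto simp: L_def mvimage_def)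
    next
      fix X assume X: "X \<in> t -` B n \<inter> K"
      then have "X \<in> space M" using KA AM by auto
      then have "X \<in> L n" using X t[of X] R_values[of X] by (auto simp: L_def mvimage_def)
      then show "X \<in> - C' n \<inter> K" using C'(1) X by auto
    qed
    show "\<exists>A. open A \<and> A \<inter> K = t -` G \<inter> K"
    proof (intro exI conjI)
      show "open (\<Union>n\<in>I. - C' n)"
        using C'(2) compact_imp_closed by auto
      show "(\<Union>n\<in>I. - C' n) \<inter> K = t -` G \<inter> K"
        using basic unfolding GI by blast
    qed
  qed
  then have "compact (t ` K)" using K by (rule compact_continuous_image)
  moreover have "(\<Union>X\<in>K. R X) = t ` K" using t by auto
  ultimately show ?thesis using K KA meas by auto
qed

text \<open>Compact sets with compact images exhaust \<open>A\<close> up to errors tending to zero.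
  Their countable union has full measure, and its image is a countable union of compact sets, hence
  Borel.\<close>

lemma ex_full_subset_with_borel_image:
  assumes A: "A \<in> sets M" "A \<subseteq> space M - singular"
  shows "\<exists>F\<subseteq>A. (\<Union>X\<in>F. R X) \<in> sets borel \<and> measure N (\<Union>X\<in>F. R X) = measure M A"
proof -
  have "\<exists>K\<subseteq>A. compact K \<and> compact (\<Union>X\<in>K. R X) \<and> measure M A \<le> measure M K + inverse (real (Suc n))" for n
    using ex_compact_with_compact_image[OF A] by simp
  then obtain K where K: "\<And>n. K n \<subseteq> A" "\<And>n. compact (K n)" "\<And>n. compact (\<Union>X\<in>K n. R X)"
      "\<And>n. measure M A \<le> measure M (K n) + inverse (real (Suc n))"
    by metis
  define F where "F = (\<Union>n. K n)"
  have FA: "F \<subseteq> A" using K(1) by (auto simp: F_def)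
  have "K n \<in> sets M" for n
    using K(1)[of n] K(2) A(2) by (intro borel_M borel_compact) auto
  then have Fs: "F \<in> sets M" unfolding F_def by auto
  have RF_eq: "(\<Union>X\<in>F. R X) = (\<Union>n. \<Union>X\<in>K n. R X)" by (auto simp: F_def)
  have "(\<Union>X\<in>K n. R X) \<in> sets borel" for n
    using K(3) by (rule borel_compact)
  then have RFs: "(\<Union>X\<in>F. R X) \<in> sets borel"
    unfolding RF_eq by (intro sets.countable_UN image_subsetI)
  have RF: "(\<Union>X\<in>F. R X) \<subseteq> space N" using FA A(2) R_values by blast
  have "measure M A \<le> measure M F"
  proof (rule field_le_epsilon)
    fix e :: real assume "e > 0"
    then obtain n where "inverse (real (Suc n)) < e" using reals_Archimedean by blast
    moreover have "measure M (K n) \<le> measure M F"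
      using Fs by (intro M.finite_measure_mono) (auto simp: F_def)
    ultimately show "measure M A \<le> measure M F + e" using K(4)[of n] by linarith
  qed
  moreover have "measure M F \<le> measure M A" using FA A by (intro M.finite_measure_mono) auto
  moreover have "measure N (\<Union>X\<in>F. R X) = measure M F"
    using measure_vimage[OF RFs RF] mvimage_image[of F] FA A(2) by (simp add: mvimage_def)
  ultimately show ?thesis using FA RFs by auto
qed

text \<open>Full parts of \<open>E\<close> and of its complement have disjoint Borel images whose
  measures add up to the total mass, so what they miss is null. The image of \<open>E\<close> avoids
  that of \<open>F'\<close>, hence exceeds that of \<open>F\<close> only within this null set, and
  completeness makes it measurable.\<close>

lemma image_sets_measure:
  assumes E: "E \<in> sets M"
  shows "(\<Union>X\<in>E. R X) \<in> sets N" and "measure N (\<Union>X\<in>E. R X) = measure M E"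
proof -
  have sing: "singular \<in> sets M" using singular_null by blast
  have EM: "E \<subseteq> space M" using E by (rule sets.sets_into_space)
  obtain F where F: "F \<subseteq> E - singular" "(\<Union>X\<in>F. R X) \<in> sets borel"
      "measure N (\<Union>X\<in>F. R X) = measure M (E - singular)"
    using ex_full_subset_with_borel_image[OF sets.Diff[OF E sing] Diff_mono[OF EM subset_refl]] by blast
  obtain F' where F': "F' \<subseteq> space M - E - singular" "(\<Union>X\<in>F'. R X) \<in> sets borel"
      "measure N (\<Union>X\<in>F'. R X) = measure M (space M - E - singular)"
    using ex_full_subset_with_borel_image[OF sets.Diff[OF sets.compl_sets[OF E] sing]
        Diff_mono[OF Diff_subset subset_refl]] by blast
  let ?RF = "\<Union>X\<in>F. R X" and ?RF' = "\<Union>X\<in>F'. R X"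
  have sub: "?RF \<subseteq> space N" "?RF' \<subseteq> space N"
    using F(1) F'(1) EM R_values by blast+
  have sets: "?RF \<in> sets N" "?RF' \<in> sets N"
    using F(2) F'(2) sub borel_N by auto
  have notS: "P \<notin> S" if "X \<in> F'" "P \<in> R X" for P X
    using that F'(1) by (auto simp: singular_def mvimage_def)
  have inj: "X = X'" if "X \<in> F'" "P \<in> R X" "X' \<in> space M" "P \<in> R X'" for P X X'
    using injective[of X X' P] notS[OF that(1,2)] that F'(1) by auto
  have disj: "?RF \<inter> ?RF' = {}"
    using inj F(1) F'(1) EM by blast
  have minus_singular: "measure M (A - singular) = measure M A" if "A \<in> sets M" for A
    using measure_Diff_null_set[OF that singular_null] .
  have "measure N (?RF \<union> ?RF') = measure M E + measure M (space M - E)"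
    using N.finite_measure_Union[OF sets disj] F(3) F'(3) E minus_singular by simp
  also have "\<dots> = measure M (space M)"
    using M.finite_measure_compl[OF E] by simp
  also have "\<dots> = measure N (space N)"
  proof -
    \<comment> \<open>Mass balance is the preimage identity for the whole target, since every point
      has an image.\<close>
    have "{X\<in>space M. R X \<inter> space N \<noteq> {}} = space M" using R_values by blast
    then show ?thesis using measure_vimage[OF borel_space_N] by simp
  qed
  finally have "measure N (space N - (?RF \<union> ?RF')) = 0"
    using N.finite_measure_compl[of "?RF \<union> ?RF'"] sets by simp
  then have "space N - (?RF \<union> ?RF') \<in> null_sets N"
    using sets by (auto simp: null_sets_def N.emeasure_eq_measure)
  moreover have "(\<Union>X\<in>E. R X) - ?RF \<subseteq> space N - (?RF \<union> ?RF')"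
    using inj F'(1) EM R_values by blast
  ultimately have null: "(\<Union>X\<in>E. R X) - ?RF \<in> null_sets N"
    by (rule N.complete2[rotated])
  have eq: "(\<Union>X\<in>E. R X) = ?RF \<union> ((\<Union>X\<in>E. R X) - ?RF)" using F(1) by auto
  show "(\<Union>X\<in>E. R X) \<in> sets N"
    by (subst eq) (rule sets.Un[OF sets(1) null_setsD2[OF null]])
  have "measure N (\<Union>X\<in>E. R X) = measure N (?RF \<union> ((\<Union>X\<in>E. R X) - ?RF))"
    using eq by (rule arg_cong)
  also have "\<dots> = measure N ?RF"
    using sets(1) null by (rule measure_Un_null_set)
  also have "\<dots> = measure M E" using F(3) minus_singular[OF E] by (rule trans)
  finally show "measure N (\<Union>X\<in>E. R X) = measure M E" .
qed

end

section \<open>Surface measures weighted by a positive density\<close>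

definition weighted_restriction :: "'a measure \<Rightarrow> 'a set \<Rightarrow> ('a \<Rightarrow> real) \<Rightarrow> 'a measure" where
  "weighted_restriction M U f = density (restrict_space M U) (\<lambda>x. ennreal (f x))"

lemma sets_weighted_restriction:
  assumes "U \<in> sets M"
  shows "A \<in> sets (weighted_restriction M U f) \<longleftrightarrow> A \<subseteq> U \<and> A \<in> sets M"
  using assms by (simp add: weighted_restriction_def sets_restrict_space_iff)

lemma space_weighted_restriction:
  assumes "U \<in> sets M"
  shows "space (weighted_restriction M U f) = U"
  using sets.sets_into_space[OF assms] by (auto simp: weighted_restriction_def space_restrict_space)

lemma weight_measurable:
  assumes "U \<in> sets M" "set_integrable M U f"
  shows "f \<in> borel_measurable (restrict_space M U)"
  using assms by (simp add: borel_measurable_restrict_space_iff set_integrable_def borel_measurable_integrable)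

lemma emeasure_weighted_restriction:
  assumes U: "U \<in> sets M" and f: "set_integrable M U f" "\<And>x. x \<in> U \<Longrightarrow> f x > 0"
    and A: "A \<in> sets M" "A \<subseteq> U"
  shows "emeasure (weighted_restriction M U f) A = ennreal (LINT x:A|M. f x)"
proof -
  have fA: "set_integrable M A f" using f(1) A by (rule set_integrable_subset)
  have "emeasure (weighted_restriction M U f) A =
      (\<integral>\<^sup>+x. ennreal (f x) * indicator A x \<partial>restrict_space M U)"
    unfolding weighted_restriction_def using weight_measurable[OF U f(1)] U A
    by (intro emeasure_density) (auto simp: sets_restrict_space_iff)
  also have "\<dots> = (\<integral>\<^sup>+x. ennreal (f x) * indicator A x * indicator U x \<partial>M)"
    using U by (intro nn_integral_restrict_space) simp
  also have "\<dots> = (\<integral>\<^sup>+x. ennreal (indicator A x *\<^sub>R f x) \<partial>M)"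
    using A(2) by (intro nn_integral_cong) (auto split: split_indicator)
  also have "\<dots> = ennreal (LINT x:A|M. f x)"
    unfolding set_lebesgue_integral_def
  proof (rule nn_integral_eq_integral)
    show "integrable M (\<lambda>x. indicator A x *\<^sub>R f x)" using fA by (simp add: set_integrable_def)
    show "AE x in M. 0 \<le> indicator A x *\<^sub>R f x"
    proof (rule AE_I2)
      fix x show "0 \<le> indicator A x *\<^sub>R f x"
        using f(2)[of x] A(2) by (cases "x \<in> A") auto
    qed
  qed
  finally show ?thesis .
qed

lemma measure_weighted_restriction:
  assumes U: "U \<in> sets M" and f: "set_integrable M U f" "\<And>x. x \<in> U \<Longrightarrow> f x > 0"
    and A: "A \<in> sets M" "A \<subseteq> U"
  shows "measure (weighted_restriction M U f) A = (LINT x:A|M. f x)"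
proof -
  have "0 \<le> indicator A x *\<^sub>R f x" for x
    using f(2)[of x] A(2) by (cases "x \<in> A") auto
  then have "0 \<le> (LINT x:A|M. f x)"
    unfolding set_lebesgue_integral_def by (intro integral_nonneg_AE AE_I2)
  then show ?thesis
    using emeasure_weighted_restriction[OF assms] by (simp add: measure_def)
qed

lemma finite_measure_weighted_restriction:
  assumes U: "U \<in> sets M" and f: "set_integrable M U f" "\<And>x. x \<in> U \<Longrightarrow> f x > 0"
  shows "finite_measure (weighted_restriction M U f)"
  using emeasure_weighted_restriction[OF U f U subset_refl] space_weighted_restriction[OF U]
  by (intro finite_measureI) simp

text \<open>A density that is positive throughout \<open>U\<close> creates no new null sets. This
  carries completeness and the null part of a completed set over to the weighted measure.\<close>

lemma null_sets_weighted_restriction: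
  assumes U: "U \<in> sets M" and f: "set_integrable M U f" "\<And>x. x \<in> U \<Longrightarrow> f x > 0"
  shows "A \<in> null_sets (weighted_restriction M U f) \<longleftrightarrow> A \<subseteq> U \<and> A \<in> null_sets M"
proof -
  have "A \<in> null_sets (weighted_restriction M U f) \<longleftrightarrow>
      A \<in> sets (restrict_space M U) \<and> (AE x in restrict_space M U. x \<in> A \<longrightarrow> ennreal (f x) = 0)"
    unfolding weighted_restriction_def using weight_measurable[OF U f(1)]
    by (intro null_sets_density_iff) simp
  also have "\<dots> \<longleftrightarrow> (A \<subseteq> U \<and> A \<in> sets M) \<and> (AE x in M. x \<in> U \<longrightarrow> x \<in> A \<longrightarrow> ennreal (f x) = 0)"
    using U by (simp add: sets_restrict_space_iff AE_restrict_space_iff)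
  also have "\<dots> \<longleftrightarrow> (A \<subseteq> U \<and> A \<in> sets M) \<and> (AE x in M. x \<notin> A)"
  proof (rule conj_cong[OF refl AE_cong])
    fix x assume "A \<subseteq> U \<and> A \<in> sets M"
    then show "(x \<in> U \<longrightarrow> x \<in> A \<longrightarrow> ennreal (f x) = 0) \<longleftrightarrow> x \<notin> A"
      using f(2)[of x] by (auto simp: ennreal_eq_0_iff)
  qed
  also have "\<dots> \<longleftrightarrow> A \<subseteq> U \<and> A \<in> null_sets M"
    using AE_iff_null_sets[of A M] null_setsD2[of A M] by blast
  finally show ?thesis .
qed

lemma complete_measure_weighted_restriction:
  assumes U: "U \<in> sets (completion m)" and f: "set_integrable (completion m) U f" "\<And>x. x \<in> U \<Longrightarrow> f x > 0"
  shows "complete_measure (weighted_restriction (completion m) U f)"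
proof
  fix A B assume "B \<subseteq> A" "A \<in> null_sets (weighted_restriction (completion m) U f)"
  then have "A \<subseteq> U" "A \<in> null_sets (completion m)"
    using null_sets_weighted_restriction[OF U f] by auto
  then show "B \<in> sets (weighted_restriction (completion m) U f)"
    using completion.complete[OF \<open>B \<subseteq> A\<close>] \<open>B \<subseteq> A\<close> by (simp add: sets_weighted_restriction[OF U])
qed

text \<open>A set of the completion is a Borel set up to a null part, and finite Borel measures on a
  Polish space are inner regular with respect to compact sets.\<close>

lemma inner_regular_weighted_restriction:
  fixes m :: "'a::polish_space measure"
  assumes m: "sets m = sets borel" and U: "U \<in> sets borel"
    and f: "set_integrable (completion m) U f" "\<And>x. x \<in> U \<Longrightarrow> f x > 0"
    and A: "A \<in> sets (weighted_restriction (completion m) U f)" and e: "(e::real) > 0"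
  defines "\<mu> \<equiv> weighted_restriction (completion m) U f"
  shows "\<exists>K\<subseteq>A. compact K \<and> measure \<mu> A \<le> measure \<mu> K + e"
proof -
  have UM: "U \<in> sets (completion m)" using U m by simp
  have A': "A \<subseteq> U" "A \<in> sets (completion m)"
    using A sets_weighted_restriction[OF UM] by auto
  interpret \<mu>: finite_measure \<mu>
    unfolding \<mu>_def by (rule finite_measure_weighted_restriction[OF UM f])
  have sets_\<mu>: "B \<in> sets \<mu>" if "B \<in> sets borel" "B \<subseteq> U" for B
    using that m sets_weighted_restriction[OF UM, of B f] by (simp add: \<mu>_def)
  have space_\<mu>: "space \<mu> = U" unfolding \<mu>_def by (rule space_weighted_restriction[OF UM])
  have id: "(\<lambda>x. x) \<in> \<mu> \<rightarrow>\<^sub>M borel"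
  proof (rule measurableI)
    fix B :: "'a set" assume "B \<in> sets borel"
    then show "(\<lambda>x. x) -` B \<inter> space \<mu> \<in> sets \<mu>" using U by (auto simp: space_\<mu> intro!: sets_\<mu>)
  qed simp
  \<comment> \<open>Pushing forward along the identity yields a measure on the full Borel algebra,
    to which \<open>inner_regular\<close> applies.\<close>
  define \<nu> where "\<nu> = distr \<mu> borel (\<lambda>x. x)"
  have \<nu>: "emeasure \<nu> B = emeasure \<mu> B" if "B \<in> sets borel" "B \<subseteq> U" for B
    using that id space_\<mu> unfolding \<nu>_def by (subst emeasure_distr) (auto simp: Int_absorb2)
  interpret \<nu>: finite_measure \<nu>
    unfolding \<nu>_def using id by (rule \<mu>.finite_measure_distr)
  define B where "B = main_part m A"
  have B: "B \<in> sets borel" "B \<subseteq> A"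
    using main_part_sets[OF A'(2)] main_part_null_part_Un[OF A'(2)] unfolding B_def m by blast+
  have BU: "B \<subseteq> U" using B A' by blast
  have "null_part m A \<in> null_sets (completion m)" using A'(2) by (rule null_part_null_sets)
  moreover have "null_part m A \<subseteq> U" using main_part_null_part_Un[OF A'(2)] A'(1) by blast
  ultimately have "null_part m A \<in> null_sets \<mu>"
    unfolding \<mu>_def by (simp add: null_sets_weighted_restriction[OF UM f])
  then have "measure \<mu> (B \<union> null_part m A) = measure \<mu> B"
    by (rule measure_Un_null_set[OF sets_\<mu>[OF B(1) BU]])
  then have AB: "measure \<mu> A = measure \<mu> B"
    using main_part_null_part_Un[OF A'(2)] by (simp add: B_def)
  have ne: "{K. K \<subseteq> B \<and> compact K} \<noteq> {}" by auto
  have "emeasure \<nu> B = (SUP K \<in> {K. K \<subseteq> B \<and> compact K}. emeasure \<nu> K)"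
    using B(1) \<nu>.emeasure_finite by (intro inner_regular) (auto simp: \<nu>_def)
  from SUP_approx_ennreal[OF e ne this] obtain K
    where K: "K \<subseteq> B" "compact K" "emeasure \<nu> B < emeasure \<nu> K + ennreal e"
    using \<nu>.emeasure_finite by auto
  have "emeasure \<mu> B \<le> emeasure \<mu> K + ennreal e"
    using K(3) \<nu>[OF B(1) BU] \<nu>[OF borel_compact[OF K(2)] order_trans[OF K(1) BU]] by simp
  then have "measure \<mu> B \<le> measure \<mu> K + e"
    using e by (simp add: \<mu>.emeasure_eq_measure ennreal_plus[symmetric] del: ennreal_plus)
  with AB K(1,2) B(2) show ?thesis by auto
qed

section \<open>The refractor problem\<close>

lemma smooth_derivative:
  fixes \<phi> :: "'a::euclidean_space \<Rightarrow> real"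
  assumes "smooth \<phi>"
  shows "\<phi> differentiable at x" and "continuous_on UNIV (\<lambda>x. frechet_derivative \<phi> (at x) v)"
proof -
  have "C_k 1 \<phi>" using assms unfolding smooth_def by blast
  then obtain f' where f': "\<And>x. (\<phi> has_derivative f' x) (at x)" "\<And>v. continuous_on UNIV (\<lambda>x. f' x v)"
    by (auto simp: One_nat_def)
  show "\<phi> differentiable at x" using f'(1) by (rule differentiableI)
  have "frechet_derivative \<phi> (at x) = f' x" for x using frechet_derivative_at[OF f'(1)] by simp
  then show "continuous_on UNIV (\<lambda>x. frechet_derivative \<phi> (at x) v)" using f'(2) by simp
qed

lemma inner_grad:
  assumes "f differentiable at x"
  shows "grad f x \<bullet> v = frechet_derivative f (at x) v"
proof -
  have lin: "linear (frechet_derivative f (at x))" using assms by (rule linear_frechet_derivative)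
  have "frechet_derivative f (at x) v = frechet_derivative f (at x) (\<Sum>b\<in>Basis. (v \<bullet> b) *\<^sub>R b)"
    by (simp add: euclidean_representation)
  also have "\<dots> = (\<Sum>b\<in>Basis. (v \<bullet> b) * frechet_derivative f (at x) b)"
    by (simp add: linear_sum[OF lin] linear_scale[OF lin])
  finally show ?thesis by (simp add: grad_def inner_commute[of _ v] inner_sum_right mult.commute)
qed

text \<open>Translates the hypothesis on the gradient of \<open>psi \<phi>\<close> into the tangent
  plane inequality required of contact points.\<close>

lemma inner_grad_psi:
  assumes "\<phi> differentiable at (fst Z)"
  shows "grad (psi \<phi>) Z \<bullet> v = snd v - frechet_derivative \<phi> (at (fst Z)) (fst v)"
proof -
  have "(\<phi> has_derivative frechet_derivative \<phi> (at (fst Z))) (at (fst Z))"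
    using assms frechet_derivative_works by blast
  from has_derivative_compose[OF has_derivative_fst[OF has_derivative_ident] this]
  have "((\<lambda>Z. snd Z - \<phi> (fst Z)) has_derivative
      (\<lambda>v. snd v - frechet_derivative \<phi> (at (fst Z)) (fst v))) (at Z)"
    by (intro has_derivative_diff has_derivative_snd has_derivative_ident)
  then have D: "(psi \<phi> has_derivative (\<lambda>v. snd v - frechet_derivative \<phi> (at (fst Z)) (fst v))) (at Z)"
    by (simp add: psi_def[abs_def])
  then have "psi \<phi> differentiable at Z" by (rule differentiableI)
  from inner_grad[OF this, of v] show ?thesis
    using frechet_derivative_at[OF D] by metis
qed

lemma closed_hypersurface:
  assumes "continuous_on UNIV \<phi>"
  shows "closed (hypersurface \<phi>)"
  unfolding hypersurface_def psi_def
  by (intro closed_Collect_eq continuous_intros continuous_on_compose2[OF assms]) auto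

lemma restrict_space_UNIV: "restrict_space M UNIV = M"
  by (rule measure_eqI) (auto simp: sets_restrict_space emeasure_restrict_space)

text \<open>The surface measure is a weighted Lebesgue measure pushed forward by the graph map,
  under which the preimage of this set is \<open>N\<close> itself; a density keeps null sets
  null.\<close>

lemma null_over_null_base:
  fixes \<phi> :: "real^'n::finite \<Rightarrow> real"
  assumes \<phi>: "smooth \<phi>" and N: "N \<in> null_sets lborel"
  shows "{Z \<in> hypersurface \<phi>. fst Z \<in> N} \<in> sets borel"
    and "{Z \<in> hypersurface \<phi>. fst Z \<in> N} \<in> null_sets (target_measure \<phi>)"
proof -
  let ?S = "{Z \<in> hypersurface \<phi>. fst Z \<in> N}"
  let ?w = "\<lambda>x. ennreal (sqrt (1 + (norm (grad \<phi> x))\<^sup>2))"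
  have cont: "continuous_on UNIV \<phi>"
    using smooth_derivative(1)[OF \<phi>]
    by (simp add: continuous_on_eq_continuous_at differentiable_imp_continuous_within)
  have "fst -` N \<in> sets (borel :: 'n space measure)"
  proof -
    have "fst \<in> borel_measurable (borel :: 'n space measure)"
      by (intro borel_measurable_continuous_onI continuous_intros)
    from measurable_sets[OF this, of N] show ?thesis using N by auto
  qed
  moreover have "?S = hypersurface \<phi> \<inter> fst -` N" by auto
  ultimately show S: "?S \<in> sets borel"
    using closed_hypersurface[OF cont] by (simp add: sets.Int borel_closed)
  have "continuous_on UNIV (grad \<phi>)"
    unfolding grad_def[abs_def] by (intro continuous_intros smooth_derivative(2)[OF \<phi>])
  then have w: "?w \<in> borel_measurable lborel"
    by (intro measurable_compose[OF _ measurable_ennreal])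
      (auto intro!: borel_measurable_continuous_onI continuous_intros)
  have "continuous_on UNIV (\<lambda>x. (x, \<phi> x))" using cont by (intro continuous_intros)
  then have graph: "(\<lambda>x. (x, \<phi> x)) \<in> density lborel ?w \<rightarrow>\<^sub>M borel"
    by (simp add: borel_measurable_continuous_onI)
  have "(\<lambda>x. (x, \<phi> x)) -` ?S \<inter> space (density lborel ?w) = N"
    by (auto simp: hypersurface_def psi_def)
  moreover have "N \<in> null_sets (density lborel ?w)"
    using N w AE_not_in[OF N] by (auto simp: null_sets_density_iff)
  ultimately have "?S \<in> null_sets (distr (density lborel ?w) borel (\<lambda>x. (x, \<phi> x)))"
    using S graph by (simp add: null_sets_distr_iff)
  then show "?S \<in> null_sets (target_measure \<phi>)"
    unfolding target_measure_def graph_surface_measure_def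
    by (intro null_sets_completionI) (simp add: restrict_space_UNIV)
qed

section \<open>From refractors to measure preserving multivalued maps\<close>

text \<open>A supporting oval with focus \<open>P\<close> says exactly that the refractor point
  maximises the path length to \<open>P\<close>, so \<open>null_multiply_covered\<close> applies
  with \<open>c\<close> equal to \<open>1 / \<kappa>\<close>.\<close>

lemma null_multiply_imaged:
  fixes \<phi> :: "real^'n::finite \<Rightarrow> real"
  assumes \<kappa>: "0 < \<kappa>" "\<kappa> < 1" and \<phi>: "smooth \<phi>"
    and U: "U \<subseteq> upper_hemisphere" and V: "V \<subseteq> hypersurface \<phi>"
    and \<rho>: "refractor \<kappa> U V \<rho>"
    and dist: "positive_distance (refractor_surface U \<rho>) V"
    and dir: "\<And>X Z. X \<in> U \<Longrightarrow> Z \<in> imaging \<kappa> U V \<rho> X \<Longrightarrow>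
      grad (psi \<phi>) Z \<bullet> ((Z - \<rho> X *\<^sub>R X) /\<^sub>R norm (Z - \<rho> X *\<^sub>R X)) > 0"
  shows "\<exists>N\<in>null_sets lborel. \<forall>X\<in>U. \<forall>X'\<in>U. \<forall>P\<in>imaging \<kappa> U V \<rho> X \<inter> imaging \<kappa> U V \<rho> X'.
    fst P \<notin> N \<longrightarrow> X = X'"
proof -
  define \<Gamma> where "\<Gamma> = refractor_surface U \<rho>"
  have pos: "\<rho> X > 0" if "X \<in> U" for X using \<rho> that by (simp add: refractor_def)
  have unit: "norm X = 1" if "X \<in> U" for X using U that by (auto simp: upper_hemisphere_def)
  have bdd: "bounded \<Gamma>"
  proof (cases "U = {}")
    case True
    then show ?thesis by (simp add: \<Gamma>_def refractor_surface_def)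
  next
    case False
    then obtain X0 where "X0 \<in> U" by blast
    \<comment> \<open>A single supporting oval bounds the whole refractor: its constant
      \<open>b\<close> dominates the norm of every point.\<close>
    then obtain P b where "supports \<kappa> U \<rho> P b X0" using \<rho> unfolding refractor_def by blast
    then have b: "\<rho> X + (1 / \<kappa>) * norm (\<rho> X *\<^sub>R X - P) \<le> b" if "X \<in> U" for X
      using that by (simp add: supports_def)
    have "norm (\<rho> X *\<^sub>R X) \<le> b" if "X \<in> U" for X
    proof -
      have "0 \<le> (1 / \<kappa>) * norm (\<rho> X *\<^sub>R X - P)" using \<kappa> by simp
      then show ?thesis using b[OF that] pos[OF that] unit[OF that] by simp
    qed
    then show ?thesis unfolding bounded_iff \<Gamma>_def refractor_surface_def by blast
  qed
  have diff: "\<phi> differentiable at z" for z using \<phi> by (rule smooth_derivative)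
  have "1 < 1 / \<kappa>" using \<kappa> by simp
  from null_multiply_covered[OF diff bdd this] obtain N where N: "N \<in> null_sets lborel"
    "{z. \<exists>M\<^sub>1 M\<^sub>2.
        (M\<^sub>1 \<in> \<Gamma> \<and> M\<^sub>1 \<noteq> (z, \<phi> z) \<and>
         (\<forall>M'\<in>\<Gamma>. norm M' + 1 / \<kappa> * norm (M' - (z, \<phi> z)) \<le> norm M\<^sub>1 + 1 / \<kappa> * norm (M\<^sub>1 - (z, \<phi> z))) \<and>
         frechet_derivative \<phi> (at z) (fst ((z, \<phi> z) - M\<^sub>1)) < snd ((z, \<phi> z) - M\<^sub>1)) \<and>
        (M\<^sub>2 \<in> \<Gamma> \<and> M\<^sub>2 \<noteq> (z, \<phi> z) \<and>
         (\<forall>M'\<in>\<Gamma>. norm M' + 1 / \<kappa> * norm (M' - (z, \<phi> z)) \<le> norm M\<^sub>2 + 1 / \<kappa> * norm (M\<^sub>2 - (z, \<phi> z))) \<and>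
         frechet_derivative \<phi> (at z) (fst ((z, \<phi> z) - M\<^sub>2)) < snd ((z, \<phi> z) - M\<^sub>2)) \<and>
        M\<^sub>1 \<noteq> M\<^sub>2} \<subseteq> N"
    by blast
  have contact: "\<rho> X *\<^sub>R X \<in> \<Gamma> \<and> \<rho> X *\<^sub>R X \<noteq> (z, \<phi> z) \<and>
      (\<forall>M'\<in>\<Gamma>. norm M' + 1 / \<kappa> * norm (M' - (z, \<phi> z)) \<le>
        norm (\<rho> X *\<^sub>R X) + 1 / \<kappa> * norm (\<rho> X *\<^sub>R X - (z, \<phi> z))) \<and>
      frechet_derivative \<phi> (at z) (fst ((z, \<phi> z) - \<rho> X *\<^sub>R X)) < snd ((z, \<phi> z) - \<rho> X *\<^sub>R X)"
    if X: "X \<in> U" and P: "(z, \<phi> z) \<in> imaging \<kappa> U V \<rho> X" for X z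
  proof (intro conjI ballI)
    let ?M = "\<rho> X *\<^sub>R X" and ?P = "(z, \<phi> z)"
    show M: "?M \<in> \<Gamma>" using X unfolding \<Gamma>_def refractor_surface_def by blast
    have "?P \<in> V" using P by (simp add: imaging_def)
    then have "dist ?M ?P > 0"
      using dist M unfolding positive_distance_def \<Gamma>_def by (meson less_le_trans)
    then show ne: "?M \<noteq> ?P" by auto
    obtain b where "supports \<kappa> U \<rho> ?P b X" using P by (auto simp: imaging_def)
    then have b: "\<rho> X' + 1 / \<kappa> * norm (\<rho> X' *\<^sub>R X' - ?P) \<le> \<rho> X + 1 / \<kappa> * norm (?M - ?P)"
      if "X' \<in> U" for X'
      using that by (simp add: supports_def)
    fix M' assume "M' \<in> \<Gamma>"
    then obtain X' where X': "X' \<in> U" "M' = \<rho> X' *\<^sub>R X'"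
      unfolding \<Gamma>_def refractor_surface_def by blast
    show "norm M' + 1 / \<kappa> * norm (M' - ?P) \<le> norm ?M + 1 / \<kappa> * norm (?M - ?P)"
      using b[OF X'(1)] pos[OF X] pos[OF X'(1)] unit[OF X] unit[OF X'(1)] by (simp add: X'(2))
  next
    let ?M = "\<rho> X *\<^sub>R X" and ?P = "(z, \<phi> z)"
    have "0 < (grad (psi \<phi>) ?P \<bullet> (?P - ?M)) / norm (?P - ?M)"
      using dir[OF X P] by (simp add: divide_inverse mult.commute)
    then have "0 < grad (psi \<phi>) ?P \<bullet> (?P - ?M)"
      by (simp add: zero_less_divide_iff)
    then show "frechet_derivative \<phi> (at z) (fst (?P - ?M)) < snd (?P - ?M)"
      using inner_grad_psi[of \<phi> ?P "?P - ?M"] diff by simp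
  qed
  have "X = X'" if XX': "X \<in> U" "X' \<in> U" and P: "P \<in> imaging \<kappa> U V \<rho> X" "P \<in> imaging \<kappa> U V \<rho> X'"
    and notin: "fst P \<notin> N" for X X' P
  proof -
    have "P \<in> V" using P(1) by (simp add: imaging_def)
    then have Pz: "P = (fst P, \<phi> (fst P))" using V by (cases P) (auto simp: hypersurface_def psi_def)
    have "\<rho> X *\<^sub>R X = \<rho> X' *\<^sub>R X'"
    proof (rule ccontr)
      assume ne: "\<rho> X *\<^sub>R X \<noteq> \<rho> X' *\<^sub>R X'"
      have "fst P \<in> N"
        using contact[OF XX'(1), of "fst P"] contact[OF XX'(2), of "fst P"] P Pz ne
        by (intro subsetD[OF N(2)] CollectI exI[of _ "\<rho> X *\<^sub>R X"] exI[of _ "\<rho> X' *\<^sub>R X'"] conjI) simp_all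
      with notin show False by contradiction
    qed
    then have eq: "\<rho> X *\<^sub>R X = \<rho> X' *\<^sub>R X'" .
    \<comment> \<open>Directions are unit vectors and radii are positive, so a refractor point
      determines first its radius and then its direction.\<close>
    have "norm (\<rho> X *\<^sub>R X) = norm (\<rho> X' *\<^sub>R X')" using eq by (rule arg_cong)
    then have "\<rho> X = \<rho> X'" using pos[OF XX'(1)] pos[OF XX'(2)] unit[OF XX'(1)] unit[OF XX'(2)] by simp
    then show ?thesis using eq pos[OF XX'(2)] by simp
  qed
  with N(1) show ?thesis by blast
qed

theorem theorem8:
  fixes \<kappa> :: real
    and \<phi> :: "real^'n::finite \<Rightarrow> real"
    and U V :: "'n space set"
    and f g \<rho> :: "'n space \<Rightarrow> real"
  assumes "CARD('n) \<ge> 2"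
    and "0 < \<kappa>" and "\<kappa> < 1"
    and "openin (top_of_set upper_hemisphere) U"
    and "smooth \<phi>"
    and "openin (top_of_set (hypersurface \<phi>)) V"
    and "set_integrable hemisphere_measure U f" and "\<forall>X\<in>U. f X > 0"
    and "set_integrable (target_measure \<phi>) V g" and "\<forall>Z\<in>V. g Z > 0"
    and "(LINT X:U|hemisphere_measure. f X) = (LINT Z:V|target_measure \<phi>. g Z)"
    and "visibility_1 \<kappa> U V" and "visibility_2 U V"
    and "brenier_solution \<kappa> \<phi> U V f g \<rho>"
    and "positive_distance {0} (refractor_surface U \<rho>)"
    and "positive_distance (refractor_surface U \<rho>) V"
    and "\<forall>X\<in>U. \<forall>Z\<in>imaging \<kappa> U V \<rho> X.
           let Y = (Z - \<rho> X *\<^sub>R X) /\<^sub>R norm (Z - \<rho> X *\<^sub>R X)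
           in snd Y > 0 \<and> snd (grad (psi \<phi>) Z) > 0 \<and> grad (psi \<phi>) Z \<bullet> Y > 0"
    and "positive_distance U V"
  shows "aleksandrov_solution \<kappa> \<phi> U V f g \<rho>"
proof -
  have \<rho>: "refractor \<kappa> U V \<rho>" using assms(14) by (simp add: brenier_solution_def)
  have U: "U \<subseteq> upper_hemisphere" and V: "V \<subseteq> hypersurface \<phi>"
    using openin_imp_subset assms(4,6) by auto
  have dir: "grad (psi \<phi>) Z \<bullet> ((Z - \<rho> X *\<^sub>R X) /\<^sub>R norm (Z - \<rho> X *\<^sub>R X)) > 0"
    if "X \<in> U" "Z \<in> imaging \<kappa> U V \<rho> X" for X Z
    using assms(17) that by (simp add: Let_def)
  have cont: "continuous_on UNIV \<phi>"
    using smooth_derivative(1)[OF assms(5)]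
    by (simp add: continuous_on_eq_continuous_at differentiable_imp_continuous_within)
  have Vb: "V \<in> sets borel"
  proof -
    obtain T where "open T" "V = hypersurface \<phi> \<inter> T" using assms(6) by (auto simp: openin_open)
    then show ?thesis using closed_hypersurface[OF cont] by (simp add: sets.Int borel_closed)
  qed
  have Ub: "U \<in> sets borel"
  proof -
    obtain T where T: "open T" "U = upper_hemisphere \<inter> T" using assms(4) by (auto simp: openin_open)
    have "upper_hemisphere = sphere 0 1 \<inter> {X :: 'n space. snd X > 0}"
      by (auto simp: upper_hemisphere_def)
    moreover have "open {X :: 'n space. snd X > 0}"
      by (intro open_Collect_less continuous_intros)
    ultimately have "upper_hemisphere \<in> sets (borel :: 'n space measure)"
      using sets.Int[OF borel_closed[OF closed_sphere] borel_open] by metis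
    with T show ?thesis by (simp add: sets.Int)
  qed
  obtain m :: "'n space measure" where m: "hemisphere_measure = completion m" "sets m = sets borel"
    by (simp add: hemisphere_measure_def graph_surface_measure_def)
  obtain m' :: "'n space measure" where m': "target_measure \<phi> = completion m'" "sets m' = sets borel"
    by (simp add: target_measure_def graph_surface_measure_def)
  have UM: "U \<in> sets hemisphere_measure" and VM: "V \<in> sets (target_measure \<phi>)"
    unfolding m(1) m'(1) using Ub Vb by (simp_all add: sets_completionI_sets m(2) m'(2))
  have f: "set_integrable hemisphere_measure U f" "\<And>X. X \<in> U \<Longrightarrow> f X > 0" using assms(7,8) by auto
  have g: "set_integrable (target_measure \<phi>) V g" "\<And>Z. Z \<in> V \<Longrightarrow> g Z > 0" using assms(9,10) by auto
  obtain N where N: "N \<in> null_sets lborel"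
    and inj: "\<And>X X' P. X \<in> U \<Longrightarrow> X' \<in> U \<Longrightarrow> P \<in> imaging \<kappa> U V \<rho> X \<Longrightarrow> P \<in> imaging \<kappa> U V \<rho> X' \<Longrightarrow>
      fst P \<notin> N \<Longrightarrow> X = X'"
    using null_multiply_imaged[OF assms(2,3,5) U V \<rho> assms(16) dir] by blast
  \<comment> \<open>Intersecting with \<open>V\<close> keeps \<open>S\<close> inside the space of
    the weighted target measure. A point of \<open>V\<close> outside \<open>S\<close> has its base
    point outside \<open>N\<close>, because \<open>V\<close> lies on the graph.\<close>
  define S where "S = {Z \<in> hypersurface \<phi>. fst Z \<in> N} \<inter> V"
  have Sb: "S \<in> sets borel" unfolding S_def using null_over_null_base(1)[OF assms(5) N] Vb by (rule sets.Int)
  have "S \<in> null_sets (target_measure \<phi>)"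
    unfolding S_def using null_over_null_base(2)[OF assms(5) N] VM by (rule null_set_Int2)
  then have S0: "S \<in> null_sets (weighted_restriction (target_measure \<phi>) V g)"
    using null_sets_weighted_restriction[OF VM g, of S] by (simp add: S_def)
  define \<mu> where "\<mu> = weighted_restriction hemisphere_measure U f"
  define \<nu> where "\<nu> = weighted_restriction (target_measure \<phi>) V g"
  have space: "space \<mu> = U" "space \<nu> = V"
    unfolding \<mu>_def \<nu>_def by (rule space_weighted_restriction[OF UM] space_weighted_restriction[OF VM])+
  have sets_\<mu>: "A \<in> sets \<mu> \<longleftrightarrow> A \<subseteq> U \<and> A \<in> sets hemisphere_measure" for A
    unfolding \<mu>_def by (rule sets_weighted_restriction[OF UM])
  have sets_\<nu>: "A \<in> sets \<nu> \<longleftrightarrow> A \<subseteq> V \<and> A \<in> sets (target_measure \<phi>)" for A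
    unfolding \<nu>_def by (rule sets_weighted_restriction[OF VM])
  have measure_\<mu>: "measure \<mu> A = (LINT X:A|hemisphere_measure. f X)" if "A \<in> sets \<mu>" for A
    using that unfolding sets_\<mu> unfolding \<mu>_def by (intro measure_weighted_restriction[OF UM f]) auto
  have measure_\<nu>: "measure \<nu> A = (LINT Z:A|target_measure \<phi>. g Z)" if "A \<in> sets \<nu>" for A
    using that unfolding sets_\<nu> unfolding \<nu>_def by (intro measure_weighted_restriction[OF VM g]) auto
  have borel_\<mu>: "A \<in> sets \<mu>" if "A \<in> sets borel" "A \<subseteq> U" for A
    using that by (simp add: sets_\<mu> m sets_completionI_sets)
  have borel_\<nu>: "A \<in> sets \<nu>" if "A \<in> sets borel" "A \<subseteq> V" for A
    using that by (simp add: sets_\<nu> m' sets_completionI_sets)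
  have brenier: "imaging_preimage \<kappa> U V \<rho> G \<in> sets \<mu> \<and> measure \<mu> (imaging_preimage \<kappa> U V \<rho> G) = measure \<nu> G"
    if G: "G \<in> sets borel" "G \<subseteq> V" for G
  proof -
    have b: "imaging_preimage \<kappa> U V \<rho> G \<in> sets hemisphere_measure"
      "(LINT X:imaging_preimage \<kappa> U V \<rho> G|hemisphere_measure. f X) = (LINT Z:G|target_measure \<phi>. g Z)"
      using assms(14) G unfolding brenier_solution_def by blast+
    have "imaging_preimage \<kappa> U V \<rho> G \<subseteq> U" unfolding imaging_preimage_def by blast
    with b(1) have "imaging_preimage \<kappa> U V \<rho> G \<in> sets \<mu>" by (simp only: sets_\<mu> simp_thms)
    then show ?thesis using b(2) borel_\<nu>[OF G] by (simp add: measure_\<mu> measure_\<nu>)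
  qed
  \<comment> \<open>Images are nonempty by the refractor property, the preimage identities are the
    Brenier property, and injectivity off \<open>S\<close> is \<open>inj\<close>. The Aleksandrov
    identity is then \<open>image_sets_measure\<close> with measures read as integrals.\<close>
  interpret measure_preserving_multimap \<mu> \<nu> "imaging \<kappa> U V \<rho>" S
  proof (rule measure_preserving_multimap.intro[OF _ _ _ measure_preserving_multimap_axioms.intro],
      unfold space)
    show "finite_measure \<mu>" unfolding \<mu>_def by (rule finite_measure_weighted_restriction[OF UM f])
    show "finite_measure \<nu>" unfolding \<nu>_def by (rule finite_measure_weighted_restriction[OF VM g])
    show "complete_measure \<nu>" unfolding \<nu>_def m'(1)
      using VM g unfolding m'(1) by (rule complete_measure_weighted_restriction)
    show "\<exists>K\<subseteq>A. compact K \<and> measure \<mu> A \<le> measure \<mu> K + e" if "A \<in> sets \<mu>" "e > 0" for A e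
      using inner_regular_weighted_restriction[OF m(2) Ub] f that unfolding \<mu>_def m(1) by blast
    show "imaging \<kappa> U V \<rho> X \<noteq> {} \<and> imaging \<kappa> U V \<rho> X \<subseteq> V" if "X \<in> U" for X
      using \<rho> that unfolding refractor_def imaging_def by blast
    show "{X\<in>U. imaging \<kappa> U V \<rho> X \<inter> G \<noteq> {}} \<in> sets \<mu>"
      "measure \<mu> {X\<in>U. imaging \<kappa> U V \<rho> X \<inter> G \<noteq> {}} = measure \<nu> G" if "G \<in> sets borel" "G \<subseteq> V" for G
      using brenier[OF that] unfolding imaging_preimage_def by blast+
    show "S \<in> null_sets \<nu>" unfolding \<nu>_def by (rule S0)
    show "X = X'" if "X \<in> U" "X' \<in> U" "P \<in> imaging \<kappa> U V \<rho> X" "P \<in> imaging \<kappa> U V \<rho> X'" "P \<notin> S" for X X' P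
    proof (rule inj[OF that(1-4)])
      have "P \<in> V" using that(3) by (simp add: imaging_def)
      then show "fst P \<notin> N" using that(5) V by (auto simp: S_def)
    qed
  qed (rule borel_\<mu> borel_\<nu> Vb Sb; assumption)+
  show ?thesis
    unfolding aleksandrov_solution_def
  proof (intro conjI ballI impI \<rho>)
    fix E :: "'n space set" assume E: "E \<in> sets borel" "E \<subseteq> U"
    have E\<mu>: "E \<in> sets \<mu>" by (rule borel_\<mu>[OF E])
    show "imaging_image \<kappa> U V \<rho> E \<in> sets (target_measure \<phi>)"
      using image_sets_measure(1)[OF E\<mu>] by (simp only: sets_\<nu> imaging_image_def simp_thms)
    show "(LINT X:E|hemisphere_measure. f X) = (LINT Z:imaging_image \<kappa> U V \<rho> E|target_measure \<phi>. g Z)"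
      using image_sets_measure[OF E\<mu>] E\<mu> by (simp add: imaging_image_def measure_\<mu> measure_\<nu>)
  qed
qed

end
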